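(* Let $m\ge1$, $n\ge m-1$ and $\lambda=(2m,2m-2,\dots,2)$. Then $$Q_\lambda(1,q,\dots,q^n)=2^mq^{2\binom{m+1}3}\prod_{i=1}^m\frac{(q^{n+1-m+i};q)_i^2}{(q;q^2)_i^2}.$$
   Context: $q$ is a generic complex parameter: $q\neq 0$ and $q$ is not a root of unity. $(a;q)_k=(1-a)(1-aq)\cdots(1-aq^{k-1})$, so $(q;q^2)_i=(1-q)(1-q^3)\cdots(1-q^{2i-1})$, and $(a;q)_k^2=\big((a;q)_k\big)^2$. For a partition $\lambda_1\ge\dots\ge\lambda_m>0$ of length $m\le N$, the Schur $Q$-polynomial is the symmetric polynomial $$Q_\lambda(x_1,\dots,x_N)=2^m\sum_{\sigma\in S_N/S_{N-m}}\sigma\Bigg(x_1^{\lambda_1}\cdots x_m^{\lambda_m}\prod_{\substack{1\le i\le m\\ i<j\le N}}\frac{x_i+x_j}{x_i-x_j}\Bigg),$$ where $S_N$ acts by permuting the variables and $S_{N-m}$ is the subgroup permuting $x_{m+1},\dots,x_N$. Here $N=n+1$. *)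

theory Defs
  imports Complex_Main "HOL-Combinatorics.Permutations"
begin

definition qpoch :: "'a::comm_ring_1 \<Rightarrow> 'a \<Rightarrow> nat \<Rightarrow> 'a"
  where "qpoch a q k = (\<Prod>j<k. 1 - a * q ^ j)"

text \<open>
  Variables are indexed from \<open>0\<close>: \<open>x 0, \<dots>, x (N - 1)\<close> stand for \<open>x\<^sub>1, \<dots>, x\<^sub>N\<close>, and the
  partition \<open>\<lambda>\<close> is the list of its (positive) parts in weakly decreasing order,
  so that \<open>m = length \<lambda>\<close>.
\<close>

definition schur_Q_term :: "nat \<Rightarrow> nat list \<Rightarrow> (nat \<Rightarrow> 'a::field) \<Rightarrow> 'a"
  where "schur_Q_term N lam x =
    (\<Prod>i<length lam. x i ^ (lam ! i)) *
    (\<Prod>i<length lam. \<Prod>j\<in>{i<..<N}. (x i + x j) / (x i - x j))"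

text \<open>
  The left cosets \<open>\<sigma> S\<^sub>N\<^sub>-\<^sub>m\<close> in \<open>S\<^sub>N\<close>, where \<open>S\<^sub>N\<^sub>-\<^sub>m\<close> permutes the last \<open>N - m\<close> indices.
\<close>

definition perm_cosets :: "nat \<Rightarrow> nat \<Rightarrow> (nat \<Rightarrow> nat) set set"
  where "perm_cosets N m =
    (\<lambda>\<sigma>. (\<lambda>\<tau>. \<sigma> \<circ> \<tau>) ` {\<tau>. \<tau> permutes {m..<N}}) ` {\<sigma>. \<sigma> permutes {..<N}}"

text \<open>
  A permutation acts by \<open>(\<sigma> f)(x) = f (x \<circ> \<sigma>)\<close>. This value is the same for all \<open>\<sigma>\<close> in
  a coset (lemma \<open>schur_Q_term_coset\<close> below), and \<open>the_elem\<close> selects it.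
  The summands are rational functions whose poles \<open>x i = x j\<close> cancel in the sum; summing their
  values computes the Schur \<open>Q\<close>-polynomial at points with pairwise distinct coordinates.
  At other points, and for \<open>length \<lambda> > N\<close>, the value is not meaningful.
\<close>

definition schur_Q :: "nat \<Rightarrow> nat list \<Rightarrow> (nat \<Rightarrow> 'a::field) \<Rightarrow> 'a"
  where "schur_Q N lam x = 2 ^ length lam *
    (\<Sum>C\<in>perm_cosets N (length lam). the_elem ((\<lambda>\<sigma>. schur_Q_term N lam (x \<circ> \<sigma>)) ` C))"

lemma schur_Q_term_permute:
  assumes "\<tau> permutes {length lam..<N}"
  shows "schur_Q_term N lam (x \<circ> \<tau>) = schur_Q_term N lam x"
proof -
  have fix_head: "\<tau> i = i" if "i < length lam" for i
    using assms that by (auto simp: permutes_def)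
  have "(\<Prod>j\<in>{i<..<N}. (x i + x (\<tau> j)) / (x i - x (\<tau> j))) =
        (\<Prod>j\<in>{i<..<N}. (x i + x j) / (x i - x j))" if "i < length lam" for i
  proof -
    have "\<tau> permutes {i<..<N}"
      using that by (intro permutes_subset[OF assms]) auto
    from prod.permute[OF this, of "\<lambda>j. (x i + x j) / (x i - x j)"]
    show ?thesis by (simp add: o_def)
  qed
  then show ?thesis
    by (simp add: schur_Q_term_def fix_head)
qed

lemma schur_Q_term_coset:
  assumes "C \<in> perm_cosets N (length lam)" and "\<sigma> \<in> C"
  shows "the_elem ((\<lambda>\<sigma>. schur_Q_term N lam (x \<circ> \<sigma>)) ` C) = schur_Q_term N lam (x \<circ> \<sigma>)"
proof -
  obtain \<rho> where C: "C = (\<lambda>\<tau>. \<rho> \<circ> \<tau>) ` {\<tau>. \<tau> permutes {length lam..<N}}"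
    using assms(1) by (auto simp: perm_cosets_def)
  have const: "schur_Q_term N lam (x \<circ> \<sigma>') = schur_Q_term N lam (x \<circ> \<rho>)" if "\<sigma>' \<in> C" for \<sigma>'
    using that schur_Q_term_permute[of _ lam N "x \<circ> \<rho>"] by (auto simp: C o_assoc)
  have "(\<lambda>\<sigma>. schur_Q_term N lam (x \<circ> \<sigma>)) ` C = {schur_Q_term N lam (x \<circ> \<sigma>)}"
    using assms(2) const by auto
  then show ?thesis by simp
qed

end

theory Submission
  imports Defs "Jordan_Normal_Form.Determinant" "HOL-Computational_Algebra.Polynomial"
    "HOL-Library.FuncSet"
begin

text \<open>
  Behind the product formula is the identity \<open>Q\<^bsub>2\<delta>\<^esub> = 2\<^sup>m s\<^sub>\<delta>\<^sup>2\<close>, where \<open>\<delta> = (m, m - 1, \<dots>, 1)\<close> is the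
  staircase and \<open>s\<^sub>\<delta>\<close> its Schur function: the factors on the right-hand side come from the contents and
  hook lengths of \<open>\<delta>\<close>, each taken twice. The two copies of \<open>s\<^sub>\<delta>\<close> arise as the two factors of a
  Hankel determinant.

  Let \<open>w\<^sub>a = \<Prod>\<^bsub>b \<noteq> a\<^esub> (x\<^sub>a + x\<^sub>b) / (x\<^sub>a - x\<^sub>b)\<close>. The summand of \<open>Q\<^sub>\<lambda>\<close> for a choice \<open>y\<^sub>1, \<dots>, y\<^sub>m\<close> of
  distinct variables is \<open>\<Prod> w(y\<^sub>i) y\<^sub>i^\<lambda>\<^sub>i\<close> times \<open>\<Prod>\<^bsub>i<j\<^esub> (y\<^sub>j - y\<^sub>i) / (y\<^sub>j + y\<^sub>i)\<close>. The last
  product is antisymmetric, so the monomial may be replaced by its antisymmetrization. For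
  \<open>\<lambda> = (2m, \<dots>, 2)\<close> that is a Vandermonde product in the squares \<open>y\<^sub>i\<^sup>2\<close>; it cancels all denominators
  and leaves the square of the Vandermonde product in the \<open>y\<^sub>i\<close>. Such a sum is a Hankel determinant
  of the moments \<open>\<mu>\<^sub>k = \<Sum> w\<^sub>a x\<^sub>a\<^sup>k\<close> (lemma \<open>sum_eq_hankel_det\<close>, theorem \<open>schur_Q_even_staircase\<close>).

  By partial fractions, for \<open>k \<ge> 1\<close>, \<open>2 \<mu>\<^sub>k = \<Sum>\<^sub>l e\<^sub>l h\<^bsub>k-l\<^esub>\<close> with the elementary and the complete symmetric
  functions, whereas \<open>\<Sum>\<^sub>l (-1)\<^sup>l e\<^sub>l h\<^bsub>k-l\<^esub> = 0\<close>. Hence \<open>\<mu>\<^sub>k\<close> is the sum over the \<open>l\<close> of either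
  parity alone. In the entry \<open>\<mu>\<^bsub>i+j+2\<^esub>\<close> with \<open>i, j < m\<close>, let \<open>l\<close> have the parity of \<open>i + m\<close>. Then for each \<open>i\<close>
  only \<open>m\<close> values of \<open>l\<close> can contribute, and the Hankel matrix is the product of a square matrix of
  \<open>e\<close>'s and a square matrix of \<open>h\<close>'s (lemma \<open>moment_factorization\<close>). Up to the order of rows and
  columns, these are the two Jacobi-Trudi matrices of \<open>\<delta>\<close>.

  At \<open>x\<^sub>a = q\<^sup>a\<close>, the \<open>q\<close>-binomial theorem makes \<open>e\<^sub>l\<close> and \<open>h\<^sub>l\<close> products. Up to row and column
  factors, both matrices then have the entries \<open>p\<^sub>j(X\<^sub>r)\<close> with the same kind of polynomials \<open>p\<^sub>j\<close> of
  degree less than \<open>m\<close>. Such a determinant depends on the points \<open>X\<^sub>r\<close> only through their Vandermonde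
  product, and at the points \<open>q\<^sup>-\<^sup>1, \<dots>, q\<^sup>-\<^sup>m\<close> the matrix is triangular (lemma \<open>interp_det\<close>).
  Collecting the factors is elementary.
\<close>

section \<open>Determinants of polynomial values\<close>

text \<open>
  Entry functions in place of matrices avoid side conditions on dimensions.
\<close>

definition detf :: "nat \<Rightarrow> (nat \<Rightarrow> nat \<Rightarrow> 'a) \<Rightarrow> 'a::comm_ring_1"
  where "detf m f = det (mat m m (\<lambda>(i, j). f i j))"

lemma detf_cong:
  assumes "\<And>i j. i < m \<Longrightarrow> j < m \<Longrightarrow> f i j = g i j"
  shows "detf m f = detf m g"
  unfolding detf_def by (rule arg_cong[where f = det], rule eq_matI) (auto simp: assms)

lemma detf_leibniz:
  "detf m f = (\<Sum>p | p permutes {..<m}. of_int (sign p) * (\<Prod>i<m. f i (p i)))"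
proof -
  have "detf m f = (\<Sum>p | p permutes {0..<m}. of_int (sign p) *
    (\<Prod>i = 0..<m. mat m m (\<lambda>(i, j). f i j) $$ (i, p i)))"
    unfolding detf_def by (rule det_def') simp
  also have "\<dots> = (\<Sum>p | p permutes {..<m}. of_int (sign p) * (\<Prod>i<m. f i (p i)))"
    unfolding atLeast0LessThan
  proof (rule sum.cong[OF refl])
    fix p assume "p \<in> {p. p permutes {..<m}}"
    then have "p i < m" if "i < m" for i
      using that permutes_in_image[of p "{..<m}" i] by auto
    then show "of_int (sign p) * (\<Prod>i<m. mat m m (\<lambda>(i, j). f i j) $$ (i, p i)) =
      of_int (sign p) * (\<Prod>i<m. f i (p i))"
      by (intro arg_cong2[where f = "(*)"] prod.cong refl) auto
  qed
  finally show ?thesis .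
qed

lemma detf_transpose: "detf m (\<lambda>i j. f j i) = detf m f"
proof -
  have "mat m m (\<lambda>(i, j). f j i) = transpose_mat (mat m m (\<lambda>(i, j). f i j))"
    by (rule eq_matI) auto
  then show ?thesis
    unfolding detf_def by (simp add: det_transpose[of _ m])
qed

lemma detf_mult: "detf m (\<lambda>i j. \<Sum>k<m. f i k * g k j) = detf m f * detf m g"
proof -
  have "mat m m (\<lambda>(i, j). \<Sum>k<m. f i k * g k j) =
    mat m m (\<lambda>(i, j). f i j) * mat m m (\<lambda>(i, j). g i j)"
    by (rule eq_matI) (auto simp: scalar_prod_def atLeast0LessThan)
  then show ?thesis
    unfolding detf_def by (simp add: det_mult[of _ m])
qed

lemma detf_scale: "detf m (\<lambda>i j. a i * b j * f i j) = (\<Prod>i<m. a i) * (\<Prod>j<m. b j) * detf m f"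
proof -
  have "(\<Prod>i<m. b (p i)) = (\<Prod>i<m. b i)" if "p permutes {..<m}" for p
    using prod.permute[OF that, of b] by (simp add: o_def)
  then show ?thesis
    by (simp add: detf_leibniz prod.distrib sum_distrib_left mult_ac)
qed

lemma detf_permute_rows:
  assumes "p permutes {..<m}"
  shows "detf m (\<lambda>i j. f (p i) j) = of_int (sign p) * detf m f"
proof -
  have p: "p permutes {0..<m}"
    using assms by (simp add: atLeast0LessThan)
  have "detf m (\<lambda>i j. f (p i) j) = det (mat m m (\<lambda>(i, j). mat m m (\<lambda>(i, j). f i j) $$ (p i, j)))"
    unfolding detf_def
    using permutes_in_image[OF assms]
    by (intro arg_cong[where f = det] eq_matI) auto
  also have "\<dots> = of_int (sign p) * detf m f"
    unfolding detf_def by (rule det_permute_rows[OF _ p]) simp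
  finally show ?thesis .
qed

lemma detf_lower_triangular:
  assumes "\<And>i j. i < j \<Longrightarrow> j < m \<Longrightarrow> f i j = 0"
  shows "detf m f = (\<Prod>i<m. f i i)"
proof -
  have "detf m f = prod_list (diag_mat (mat m m (\<lambda>(i, j). f i j)))"
    unfolding detf_def by (rule det_lower_triangular[where n = m]) (auto simp: assms)
  also have "\<dots> = (\<Prod>i<m. f i i)"
    by (simp add: prod_list_diag_prod atLeast0LessThan)
  finally show ?thesis .
qed

definition vandermonde :: "nat \<Rightarrow> (nat \<Rightarrow> 'a) \<Rightarrow> 'a::comm_ring_1"
  where "vandermonde m x = (\<Prod>j<m. \<Prod>i<j. x j - x i)"

lemma detf_poly_powers:
  fixes p :: "nat \<Rightarrow> 'a::comm_ring_1 poly"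
  assumes "\<And>j. j < m \<Longrightarrow> degree (p j) < m"
  shows "detf m (\<lambda>i j. poly (p j) (x i)) = detf m (\<lambda>i k. x i ^ k) * detf m (\<lambda>k j. coeff (p j) k)"
proof -
  have "poly (p j) (x i) = (\<Sum>k<m. x i ^ k * coeff (p j) k)" if "j < m" for i j
  proof -
    have "poly (p j) (x i) = (\<Sum>k\<le>degree (p j). coeff (p j) k * x i ^ k)"
      by (rule poly_altdef)
    also have "\<dots> = (\<Sum>k<m. coeff (p j) k * x i ^ k)"
      using assms[OF that] by (intro sum.mono_neutral_left) (auto simp: coeff_eq_0)
    finally show ?thesis by (simp add: mult.commute)
  qed
  then show ?thesis
    by (subst detf_mult[symmetric]) (auto intro!: detf_cong)
qed

text \<open>
  The Newton basis \<open>\<Prod>\<^bsub>s<j\<^esub> (X - x s)\<close> is unitriangular over the monomials, so it has the same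
  determinant; but its values at the points \<open>x i\<close> form a triangular matrix.
\<close>

lemma vandermonde_det:
  fixes x :: "nat \<Rightarrow> 'a::idom"
  shows "detf m (\<lambda>i k. x i ^ k) = vandermonde m x"
proof -
  define p where "p j = (\<Prod>s<j. [:- x s, 1:])" for j :: nat
  have deg: "degree (p j) = j" for j
    unfolding p_def by (subst degree_prod_eq_sum_degree) auto
  have lead: "coeff (p j) j = 1" for j
    using lead_coeff_prod[of "\<lambda>s. [:- x s, 1:]" "{..<j}"] deg[of j] by (simp add: p_def)
  have "detf m (\<lambda>k j. coeff (p j) k) = detf m (\<lambda>k j. coeff (p k) j)"
    by (rule detf_transpose[symmetric])
  also have "\<dots> = 1"
    by (subst detf_lower_triangular) (auto simp: lead deg coeff_eq_0)
  finally have "detf m (\<lambda>i j. poly (p j) (x i)) = detf m (\<lambda>i k. x i ^ k)"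
    by (subst detf_poly_powers) (auto simp: deg)
  moreover have "detf m (\<lambda>i j. poly (p j) (x i)) = (\<Prod>i<m. poly (p i) (x i))"
    by (rule detf_lower_triangular) (auto simp: p_def poly_prod)
  ultimately show ?thesis
    by (simp add: vandermonde_def p_def poly_prod)
qed

text \<open>
  The coefficient matrix of the polynomials \<open>p j\<close> is a common factor of both sides: a determinant of
  polynomials of degree less than \<open>m\<close> can be computed at any convenient set of points.
\<close>

lemma detf_poly:
  fixes p :: "nat \<Rightarrow> 'a::idom poly"
  assumes "\<And>j. j < m \<Longrightarrow> degree (p j) < m"
  shows "detf m (\<lambda>i j. poly (p j) (x i)) * vandermonde m y = detf m (\<lambda>i j. poly (p j) (y i)) * vandermonde m x"
  using assms by (simp add: detf_poly_powers vandermonde_det)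

section \<open>From antisymmetric sums to Hankel determinants\<close>

lemma vandermonde_permute:
  fixes x :: "nat \<Rightarrow> 'a::idom"
  assumes "p permutes {..<m}"
  shows "vandermonde m (\<lambda>i. x (p i)) = of_int (sign p) * vandermonde m x"
  using detf_permute_rows[OF assms, of "\<lambda>i k. x i ^ k"] by (simp add: vandermonde_det)

lemma vandermonde_eq_0:
  fixes x :: "nat \<Rightarrow> 'a::idom"
  shows "vandermonde m x = 0 \<longleftrightarrow> (\<exists>j<m. \<exists>i<j. x j = x i)"
  by (auto simp: vandermonde_def)

definition rev_perm :: "nat \<Rightarrow> nat \<Rightarrow> nat"
  where "rev_perm m i = (if i < m then m - 1 - i else i)"

lemma rev_perm_permutes: "rev_perm m permutes {..<m}"
proof (rule bij_imp_permutes)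
  show "bij_betw (rev_perm m) {..<m} {..<m}"
    by (rule bij_betwI[where g = "rev_perm m"]) (auto simp: rev_perm_def)
qed (auto simp: rev_perm_def)

text \<open>
  The sign can be read off from the effect of the reversal on the Vandermonde product of
  \<open>0, 1, \<dots>, m - 1\<close>, where it negates each factor.
\<close>

lemma sign_rev_perm: "of_int (sign (rev_perm m)) = (\<Prod>j<m. \<Prod>i<j. - 1 :: 'a::comm_ring_1)"
proof -
  have "vandermonde m (\<lambda>i. int (rev_perm m i)) = (\<Prod>j<m. \<Prod>i<j. - 1 * (int j - int i))"
    unfolding vandermonde_def by (intro prod.cong) (auto simp: rev_perm_def)
  also have "\<dots> = (\<Prod>j<m. \<Prod>i<j. - 1) * vandermonde m int"
    unfolding vandermonde_def prod.distrib ..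
  finally have "sign (rev_perm m) * vandermonde m int = (\<Prod>j<m. \<Prod>i<j. - 1) * vandermonde m int"
    using vandermonde_permute[OF rev_perm_permutes, of m int] by simp
  moreover have "vandermonde m int \<noteq> 0"
    by (auto simp: vandermonde_eq_0)
  ultimately have "sign (rev_perm m) = (\<Prod>j<m. \<Prod>i<j. - 1)"
    by simp
  then show ?thesis
    by (simp del: prod_constant)
qed

lemma sum_PiE_permute:
  assumes "p permutes {..<m}"
  shows "(\<Sum>f\<in>{..<m} \<rightarrow>\<^sub>E S. F (f \<circ> p)) = (\<Sum>f\<in>{..<m} \<rightarrow>\<^sub>E S. F f)"
proof (rule sum.reindex_bij_witness[where i = "\<lambda>f. f \<circ> Hilbert_Choice.inv p" and j = "\<lambda>f. f \<circ> p"])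
  have mem: "f \<circ> r \<in> {..<m} \<rightarrow>\<^sub>E S" if "f \<in> {..<m} \<rightarrow>\<^sub>E S" "r permutes {..<m}" for f r
  proof (rule PiE_I)
    fix i assume "i \<in> {..<m}"
    then have "r i \<in> {..<m}" using permutes_in_image[OF that(2)] by blast
    then show "(f \<circ> r) i \<in> S" using that(1) by auto
  next
    fix i assume i: "i \<notin> {..<m}"
    then have "r i = i" using permutes_not_in[OF that(2)] by blast
    then show "(f \<circ> r) i = undefined" using that(1) i by auto
  qed
  show "f \<circ> p \<in> {..<m} \<rightarrow>\<^sub>E S" if "f \<in> {..<m} \<rightarrow>\<^sub>E S" for f
    using mem[OF that assms] .
  show "f \<circ> Hilbert_Choice.inv p \<in> {..<m} \<rightarrow>\<^sub>E S" if "f \<in> {..<m} \<rightarrow>\<^sub>E S" for f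
    using mem[OF that permutes_inv[OF assms]] .
qed (simp_all add: o_assoc[symmetric] permutes_inv_o[OF assms])

text \<open>
  Permuting the arguments of \<open>f\<close> permutes the summands and costs a sign in \<open>A\<close>; averaging over all
  permutations turns the product into its Leibniz sum.
\<close>

lemma sum_antisymmetrize:
  fixes A :: "(nat \<Rightarrow> 'b) \<Rightarrow> 'a::comm_ring_1"
  assumes "\<And>f p. p permutes {..<m} \<Longrightarrow> A (f \<circ> p) = of_int (sign p) * A f"
  shows "of_nat (fact m) * (\<Sum>f\<in>{..<m} \<rightarrow>\<^sub>E S. A f * (\<Prod>i<m. g i (f i))) =
    (\<Sum>f\<in>{..<m} \<rightarrow>\<^sub>E S. A f * detf m (\<lambda>i j. g i (f j)))"
proof -
  have each: "(\<Sum>f\<in>{..<m} \<rightarrow>\<^sub>E S. A f * (\<Prod>i<m. g i (f i))) =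
      (\<Sum>f\<in>{..<m} \<rightarrow>\<^sub>E S. A f * (of_int (sign p) * (\<Prod>i<m. g i (f (p i)))))"
    if "p permutes {..<m}" for p
    using sum_PiE_permute[OF that, where S = S and F = "\<lambda>f. A f * (\<Prod>i<m. g i (f i))"]
    by (simp add: assms[OF that] mult_ac)
  have "(\<Sum>p | p permutes {..<m}. \<Sum>f\<in>{..<m} \<rightarrow>\<^sub>E S. A f * (\<Prod>i<m. g i (f i))) =
    (\<Sum>p | p permutes {..<m}. \<Sum>f\<in>{..<m} \<rightarrow>\<^sub>E S. A f * (of_int (sign p) * (\<Prod>i<m. g i (f (p i)))))"
    by (rule sum.cong[OF refl], rule each) simp
  also have "\<dots> = (\<Sum>f\<in>{..<m} \<rightarrow>\<^sub>E S. A f * detf m (\<lambda>i j. g i (f j)))"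
    by (subst sum.swap) (simp add: detf_leibniz sum_distrib_left)
  finally show ?thesis
    by (simp add: card_permutations[OF refl])
qed

text \<open>
  With \<open>V\<close> and \<open>V2\<close> the Vandermonde products in the \<open>x (f i)\<close> and in their squares, the antisymmetric
  factor on the left is \<open>V\<^sup>2 / V2\<close>. Antisymmetrizing the monomial with exponents \<open>2, 4, \<dots>, 2 m\<close>
  produces a factor \<open>V2\<close>, which leaves \<open>V\<^sup>2\<close>. The same sum with \<open>V\<^sup>2\<close> comes from antisymmetrizing the
  monomial in \<open>V \<cdot> \<Prod> x (f i)^i\<close>, and there the Leibniz expansion of the remaining \<open>V\<close> separates the
  variables.
\<close>

lemma sum_eq_hankel_det:
  fixes x w :: "nat \<Rightarrow> 'a::field_char_0"
  assumes "finite S"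
    and sq: "\<And>a b. a \<in> S \<Longrightarrow> b \<in> S \<Longrightarrow> a \<noteq> b \<Longrightarrow> (x a)\<^sup>2 \<noteq> (x b)\<^sup>2"
  shows "(\<Sum>f\<in>{..<m} \<rightarrow>\<^sub>E S. (\<Prod>j<m. \<Prod>i<j. (x (f j) - x (f i)) / (x (f j) + x (f i))) *
      (\<Prod>i<m. w (f i) * x (f i) ^ (2 * (m - i)))) =
    (\<Prod>j<m. \<Prod>i<j. - 1) * detf m (\<lambda>i j. \<Sum>a\<in>S. w a * x a ^ (i + j + 2))"
proof -
  define V where "V f = vandermonde m (\<lambda>i. x (f i))" for f
  define V2 where "V2 f = vandermonde m (\<lambda>i. (x (f i))\<^sup>2)" for f
  define R where "R f = (\<Prod>j<m. \<Prod>i<j. (x (f j) - x (f i)) / (x (f j) + x (f i)))" for f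
  define F where "F = {..<m} \<rightarrow>\<^sub>E S"
  \<comment> \<open>Division by zero is harmless here: if the denominator of \<open>R\<close> vanishes, both sides are \<open>0\<close>.\<close>
  have R_eq: "R f = (V f)\<^sup>2 / V2 f" for f
  proof -
    have "V2 f = V f * (\<Prod>j<m. \<Prod>i<j. x (f j) + x (f i))"
      by (simp add: V_def V2_def vandermonde_def flip: prod.distrib)
        (simp add: power2_eq_square algebra_simps)
    moreover have "R f = V f / (\<Prod>j<m. \<Prod>i<j. x (f j) + x (f i))"
      by (simp add: R_def V_def vandermonde_def prod_dividef)
    ultimately show ?thesis
      by (simp add: power2_eq_square)
  qed
  have V_perm: "V (f \<circ> p) = of_int (sign p) * V f" if "p permutes {..<m}" for f p
    using vandermonde_permute[OF that, of "\<lambda>i. x (f i)"] by (simp add: V_def)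
  have V2_perm: "V2 (f \<circ> p) = of_int (sign p) * V2 f" if "p permutes {..<m}" for f p
    using vandermonde_permute[OF that, of "\<lambda>i. (x (f i))\<^sup>2"] by (simp add: V2_def)
  have R_perm: "R (f \<circ> p) = of_int (sign p) * R f" if "p permutes {..<m}" for f p
    by (cases "sign p = 1")
      (auto simp: R_eq V_perm[OF that] V2_perm[OF that] sign_def split: if_splits)
  have R_V2: "R f * V2 f = (V f)\<^sup>2" if "f \<in> F" for f
  proof (cases "V2 f = 0")
    case True
    then obtain j i where ij: "j < m" "i < j" "(x (f j))\<^sup>2 = (x (f i))\<^sup>2"
      by (auto simp: V2_def vandermonde_eq_0)
    moreover have "f i \<in> S" "f j \<in> S"
      using that ij(1,2) PiE_mem[of f "{..<m}" "\<lambda>_. S"] by (simp_all add: F_def)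
    ultimately have "x (f j) = x (f i)"
      using sq[of "f j" "f i"] by metis
    then have "V f = 0"
      unfolding V_def vandermonde_eq_0 using ij(1,2) by blast
    then show ?thesis by (simp add: R_eq)
  qed (simp add: R_eq)
  \<comment> \<open>Reversing the order of the exponents matches them with the standard Vandermonde matrix.\<close>
  have "(\<Sum>f\<in>F. R f * (\<Prod>i<m. w (f i) * x (f i) ^ (2 * (m - i)))) =
    (\<Sum>f\<in>F. R (f \<circ> rev_perm m) *
      (\<Prod>i<m. w (f (rev_perm m i)) * x (f (rev_perm m i)) ^ (2 * (m - i))))"
    unfolding F_def by (subst sum_PiE_permute[OF rev_perm_permutes, symmetric]) simp
  also have "\<dots> = (\<Sum>f\<in>F. of_int (sign (rev_perm m)) *
      (R f * (\<Prod>i<m. w (f i) * x (f i) ^ (2 * (i + 1)))))"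
  proof (rule sum.cong[OF refl])
    fix f
    have "(\<Prod>i<m. w (f (rev_perm m i)) * x (f (rev_perm m i)) ^ (2 * (m - i))) =
      (\<Prod>i<m. w (f (rev_perm m i)) * x (f (rev_perm m i)) ^ (2 * (rev_perm m i + 1)))"
    proof (rule prod.cong[OF refl])
      fix i assume "i \<in> {..<m}"
      then have "m - i = rev_perm m i + 1"
        by (auto simp: rev_perm_def)
      then show "w (f (rev_perm m i)) * x (f (rev_perm m i)) ^ (2 * (m - i)) =
        w (f (rev_perm m i)) * x (f (rev_perm m i)) ^ (2 * (rev_perm m i + 1))"
        by (simp only:)
    qed
    also have "\<dots> = (\<Prod>i<m. w (f i) * x (f i) ^ (2 * (i + 1)))"
      using prod.permute[OF rev_perm_permutes,
        of "\<lambda>i. w (f i) * x (f i) ^ (2 * (i + 1))" m] by (simp only: o_def)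
    finally show "R (f \<circ> rev_perm m) *
      (\<Prod>i<m. w (f (rev_perm m i)) * x (f (rev_perm m i)) ^ (2 * (m - i))) =
      of_int (sign (rev_perm m)) * (R f * (\<Prod>i<m. w (f i) * x (f i) ^ (2 * (i + 1))))"
      by (simp add: R_perm[OF rev_perm_permutes] mult_ac)
  qed
  also have "\<dots> = (\<Prod>j<m. \<Prod>i<j. - 1) * (\<Sum>f\<in>F. R f * (\<Prod>i<m. w (f i) * x (f i) ^ (2 * (i + 1))))"
    by (simp only: sign_rev_perm sum_distrib_left)
  also have "(\<Sum>f\<in>F. R f * (\<Prod>i<m. w (f i) * x (f i) ^ (2 * (i + 1)))) =
    (\<Sum>f\<in>F. V f * (\<Prod>i<m. w (f i) * x (f i) ^ (i + 2)))"
  proof -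
    define K where "K = (\<Sum>f\<in>F. (V f)\<^sup>2 * (\<Prod>i<m. w (f i) * (x (f i))\<^sup>2))"
    have det2: "detf m (\<lambda>i j. w (f j) * x (f j) ^ (2 * (i + 1))) =
        (\<Prod>i<m. w (f i) * (x (f i))\<^sup>2) * V2 f" for f
    proof -
      have "detf m (\<lambda>i j. w (f j) * x (f j) ^ (2 * (i + 1))) =
        detf m (\<lambda>i j. w (f i) * x (f i) ^ (2 * (j + 1)))"
        by (rule detf_transpose)
      also have "\<dots> = detf m (\<lambda>i j. (w (f i) * (x (f i))\<^sup>2) * 1 * ((x (f i))\<^sup>2) ^ j)"
        by (rule detf_cong) (simp add: power_add power_mult power2_eq_square)
      also have "\<dots> = (\<Prod>i<m. w (f i) * (x (f i))\<^sup>2) * V2 f"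
        unfolding detf_scale vandermonde_det V2_def by simp
      finally show ?thesis .
    qed
    have det1: "detf m (\<lambda>i j. w (f j) * x (f j) ^ (i + 2)) =
        (\<Prod>i<m. w (f i) * (x (f i))\<^sup>2) * V f" for f
    proof -
      have "detf m (\<lambda>i j. w (f j) * x (f j) ^ (i + 2)) =
        detf m (\<lambda>i j. w (f i) * x (f i) ^ (j + 2))"
        by (rule detf_transpose)
      also have "\<dots> = detf m (\<lambda>i j. (w (f i) * (x (f i))\<^sup>2) * 1 * (x (f i)) ^ j)"
        by (rule detf_cong) (simp add: power_add power2_eq_square)
      also have "\<dots> = (\<Prod>i<m. w (f i) * (x (f i))\<^sup>2) * V f"
        unfolding detf_scale vandermonde_det V_def by simp
      finally show ?thesis .
    qed
    have "of_nat (fact m) * (\<Sum>f\<in>F. R f * (\<Prod>i<m. w (f i) * x (f i) ^ (2 * (i + 1)))) =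
      (\<Sum>f\<in>F. R f * detf m (\<lambda>i j. w (f j) * x (f j) ^ (2 * (i + 1))))"
      unfolding F_def by (rule sum_antisymmetrize[OF R_perm])
    also have "\<dots> = K"
      unfolding K_def det2
    proof (rule sum.cong[OF refl])
      fix f assume "f \<in> F"
      show "R f * ((\<Prod>i<m. w (f i) * (x (f i))\<^sup>2) * V2 f) =
        (V f)\<^sup>2 * (\<Prod>i<m. w (f i) * (x (f i))\<^sup>2)"
        unfolding R_V2[OF \<open>f \<in> F\<close>, symmetric] by (rule mult.left_commute[THEN trans]) (simp only: mult_ac)
    qed
    also have "K = (\<Sum>f\<in>F. V f * detf m (\<lambda>i j. w (f j) * x (f j) ^ (i + 2)))"
      unfolding K_def det1 by (intro sum.cong refl) (simp only: power2_eq_square mult_ac)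
    also have "\<dots> = of_nat (fact m) * (\<Sum>f\<in>F. V f * (\<Prod>i<m. w (f i) * x (f i) ^ (i + 2)))"
      unfolding F_def by (rule sum_antisymmetrize[OF V_perm, symmetric])
    finally show ?thesis
      by simp
  qed
  also have "\<dots> = detf m (\<lambda>i j. \<Sum>a\<in>S. w a * x a ^ (i + j + 2))"
  proof -
    have "(\<Sum>f\<in>F. V f * (\<Prod>i<m. w (f i) * x (f i) ^ (i + 2))) =
      (\<Sum>f\<in>F. \<Sum>p | p permutes {..<m}.
        of_int (sign p) * (\<Prod>i<m. w (f i) * x (f i) ^ (i + p i + 2)))"
    proof (rule sum.cong[OF refl])
      fix f
      have "V f * (\<Prod>i<m. w (f i) * x (f i) ^ (i + 2)) =
        (\<Sum>p | p permutes {..<m}. of_int (sign p) *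
          ((\<Prod>i<m. x (f i) ^ p i) * (\<Prod>i<m. w (f i) * x (f i) ^ (i + 2))))"
        unfolding V_def vandermonde_det[symmetric] detf_leibniz
        by (simp only: sum_distrib_right mult.assoc)
      also have "\<dots> = (\<Sum>p | p permutes {..<m}. of_int (sign p) *
          (\<Prod>i<m. w (f i) * x (f i) ^ (i + p i + 2)))"
        unfolding prod.distrib[symmetric] power_add
        by (simp only: mult_ac)
      finally show "V f * (\<Prod>i<m. w (f i) * x (f i) ^ (i + 2)) =
        (\<Sum>p | p permutes {..<m}. of_int (sign p) *
          (\<Prod>i<m. w (f i) * x (f i) ^ (i + p i + 2)))" .
    qed
    also have "\<dots> = (\<Sum>p | p permutes {..<m}. of_int (sign p) *
        (\<Prod>i<m. \<Sum>a\<in>S. w a * x a ^ (i + p i + 2)))"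
      unfolding F_def using \<open>finite S\<close>
      by (subst sum.swap) (simp add: prod_sum_PiE sum_distrib_left)
    finally show ?thesis
      by (simp add: detf_leibniz)
  qed
  finally show ?thesis
    unfolding R_def F_def .
qed

section \<open>The sum over cosets\<close>

text \<open>
  Two maps with the same fibres have images in bijection. This passes from cosets to
  injections, since both are quotients of the symmetric group by the same relation.
\<close>

lemma sum_image_same_fibres:
  assumes fib: "\<And>a b. a \<in> P \<Longrightarrow> b \<in> P \<Longrightarrow> c a = c b \<longleftrightarrow> r a = r b"
    and val: "\<And>a. a \<in> P \<Longrightarrow> F (c a) = t (r a)"
  shows "sum F (c ` P) = sum t (r ` P)"
proof (rule sum.reindex_bij_witness[where i = "\<lambda>y. c (inv_into P r y)" and j = "\<lambda>y. r (inv_into P c y)"])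
  have c: "inv_into P c y \<in> P" "c (inv_into P c y) = y" if "y \<in> c ` P" for y
    using that by (auto intro: inv_into_into f_inv_into_f)
  have r: "inv_into P r y \<in> P" "r (inv_into P r y) = y" if "y \<in> r ` P" for y
    using that by (auto intro: inv_into_into f_inv_into_f)
  show "r (inv_into P c y) \<in> r ` P" if "y \<in> c ` P" for y
    using c[OF that] by blast
  then show "c (inv_into P r (r (inv_into P c y))) = y" if "y \<in> c ` P" for y
    using that c[OF that] r fib by metis
  show "c (inv_into P r y) \<in> c ` P" if "y \<in> r ` P" for y
    using r[OF that] by blast
  then show "r (inv_into P c (c (inv_into P r y))) = y" if "y \<in> r ` P" for y
    using that r[OF that] c fib by metis
  show "t (r (inv_into P c y)) = F y" if "y \<in> c ` P" for y
    using c[OF that] val by metis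
qed

lemma coset_eq_iff:
  fixes m N :: nat
  assumes "\<sigma> permutes {..<N}" "\<rho> permutes {..<N}"
  shows "(\<lambda>\<tau>. \<sigma> \<circ> \<tau>) ` {\<tau>. \<tau> permutes {m..<N}} = (\<lambda>\<tau>. \<rho> \<circ> \<tau>) ` {\<tau>. \<tau> permutes {m..<N}} \<longleftrightarrow>
    (\<forall>i<m. \<sigma> i = \<rho> i)"
    (is "?C \<sigma> = ?C \<rho> \<longleftrightarrow> _")
proof
  assume eq: "?C \<sigma> = ?C \<rho>"
  have "\<sigma> \<in> ?C \<sigma>"
    by (rule image_eqI[of _ _ id]) auto
  then obtain \<tau> where \<tau>: "\<tau> permutes {m..<N}" "\<sigma> = \<rho> \<circ> \<tau>"
    unfolding eq by auto
  then show "\<forall>i<m. \<sigma> i = \<rho> i"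
  proof (intro allI impI)
    fix i assume "i < m"
    then have "\<tau> i = i" by (intro permutes_not_in[OF \<tau>(1)]) auto
    then show "\<sigma> i = \<rho> i" by (simp add: \<tau>(2))
  qed
next
  have sub: "?C \<sigma> \<subseteq> ?C \<rho>"
    if \<sigma>: "\<sigma> permutes {..<N}" and \<rho>: "\<rho> permutes {..<N}" and agree: "\<forall>i<m. \<sigma> i = \<rho> i"
    for \<sigma> \<rho> :: "nat \<Rightarrow> nat"
  proof -
    define \<kappa> where "\<kappa> = Hilbert_Choice.inv \<rho> \<circ> \<sigma>"
    have "\<kappa> permutes {..<N}"
      unfolding \<kappa>_def by (intro permutes_compose \<sigma> permutes_inv \<rho>)
    then have \<kappa>: "\<kappa> permutes {m..<N}"
    proof (rule permutes_superset)
      fix i assume "i \<in> {..<N} - {m..<N}"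
      then have "\<sigma> i = \<rho> i" using agree by auto
      then show "\<kappa> i = i"
        using permutes_inverses(2)[OF \<rho>] by (simp add: \<kappa>_def)
    qed
    have "\<rho> \<circ> \<kappa> = \<sigma>"
      by (simp add: \<kappa>_def o_assoc permutes_inv_o[OF \<rho>])
    then have "\<sigma> \<circ> \<tau> = \<rho> \<circ> (\<kappa> \<circ> \<tau>)" for \<tau>
      by (simp add: o_assoc)
    then show ?thesis
      using permutes_compose[OF _ \<kappa>] by blast
  qed
  assume "\<forall>i<m. \<sigma> i = \<rho> i"
  then show "?C \<sigma> = ?C \<rho>"
    using sub[OF assms] sub[OF assms(2,1)] by auto
qed

text \<open>
  An injection extends to a permutation because its domain and its image have complements of equal
  size.
\<close>

lemma restrict_permutations:
  fixes m N :: nat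
  assumes "m \<le> N"
  shows "(\<lambda>\<sigma>. restrict \<sigma> {..<m}) ` {\<sigma>. \<sigma> permutes {..<N}} =
    {f \<in> {..<m} \<rightarrow>\<^sub>E {..<N}. inj_on f {..<m}}" (is "?L = ?R")
proof
  show "?L \<subseteq> ?R"
  proof clarify
    fix \<sigma> :: "nat \<Rightarrow> nat" assume \<sigma>: "\<sigma> permutes {..<N}"
    have "\<sigma> i \<in> {..<N}" if "i < m" for i
      using permutes_in_image[OF \<sigma>, of i] that assms by auto
    moreover have "inj_on \<sigma> {..<m}"
      using permutes_inj[OF \<sigma>] by (rule inj_on_subset) simp
    ultimately show "restrict \<sigma> {..<m} \<in> {..<m} \<rightarrow>\<^sub>E {..<N} \<and> inj_on (restrict \<sigma> {..<m}) {..<m}"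
      by (auto simp: inj_on_def)
  qed
  show "?R \<subseteq> ?L"
  proof
    fix f assume "f \<in> ?R"
    then have f: "f \<in> {..<m} \<rightarrow>\<^sub>E {..<N}" and inj: "inj_on f {..<m}" by auto
    have sub: "f ` {..<m} \<subseteq> {..<N}" using f by auto
    have "card {m..<N} = card ({..<N} - f ` {..<m})"
      using sub by (simp add: card_Diff_subset card_image[OF inj])
    then obtain g where g: "bij_betw g {m..<N} ({..<N} - f ` {..<m})"
      using finite_same_card_bij by blast
    define \<sigma> where "\<sigma> i = (if i < m then f i else if i < N then g i else i)" for i
    have "bij_betw \<sigma> {..<m} (f ` {..<m})"
      using inj by (auto simp: \<sigma>_def bij_betw_def inj_on_def)
    moreover have "bij_betw \<sigma> {m..<N} ({..<N} - f ` {..<m})"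
      using g assms by (subst bij_betw_cong[of _ _ g]) (auto simp: \<sigma>_def)
    ultimately have "bij_betw \<sigma> ({..<m} \<union> {m..<N}) (f ` {..<m} \<union> ({..<N} - f ` {..<m}))"
      by (rule bij_betw_combine) auto
    moreover have "{..<m} \<union> {m..<N} = {..<N}" "f ` {..<m} \<union> ({..<N} - f ` {..<m}) = {..<N}"
      using assms sub by auto
    ultimately have "\<sigma> permutes {..<N}"
      using assms by (intro bij_imp_permutes) (auto simp: \<sigma>_def)
    moreover have "restrict \<sigma> {..<m} = f"
    proof
      fix i show "restrict \<sigma> {..<m} i = f i"
        using PiE_arb[OF f, of i] by (simp add: \<sigma>_def)
    qed
    ultimately show "f \<in> ?L" by blast
  qed
qed

text \<open>
  Up to the factor \<open>2 x\<^sub>a\<close>, this is the residue of \<open>\<Prod>\<^sub>b (t + x\<^sub>b) / (t - x\<^sub>b)\<close> at \<open>t = x\<^sub>a\<close>.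
\<close>

definition swap_weight :: "nat \<Rightarrow> (nat \<Rightarrow> 'a) \<Rightarrow> nat \<Rightarrow> 'a::field"
  where "swap_weight N x a = (\<Prod>b\<in>{..<N} - {a}. (x a + x b) / (x a - x b))"

text \<open>
  Each weight contains the factors for all \<open>b\<close> different from \<open>\<sigma> i\<close>, whereas the summand has only
  those for the later positions. Dividing by the factors of the earlier positions gives the
  antisymmetric product.
\<close>

lemma schur_Q_term_eq:
  fixes x :: "nat \<Rightarrow> 'a::field"
  assumes \<sigma>: "\<sigma> permutes {..<N}" and len: "length lam \<le> N"
    and dist: "\<And>a b. a < N \<Longrightarrow> b < N \<Longrightarrow> a \<noteq> b \<Longrightarrow> x a - x b \<noteq> 0 \<and> x a + x b \<noteq> 0"
  shows "schur_Q_term N lam (x \<circ> \<sigma>) =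
    (\<Prod>j<length lam. \<Prod>i<j. (x (\<sigma> j) - x (\<sigma> i)) / (x (\<sigma> j) + x (\<sigma> i))) *
    (\<Prod>i<length lam. swap_weight N x (\<sigma> i) * x (\<sigma> i) ^ (lam ! i))"
proof -
  define \<phi> where "\<phi> i j = (x (\<sigma> i) + x (\<sigma> j)) / (x (\<sigma> i) - x (\<sigma> j))" for i j
  have split: "(\<Prod>j\<in>{i<..<N}. \<phi> i j) =
    (\<Prod>j<i. (x (\<sigma> i) - x (\<sigma> j)) / (x (\<sigma> i) + x (\<sigma> j))) * swap_weight N x (\<sigma> i)"
    if i: "i < length lam" for i
  proof -
    have iN: "i < N" using i len by simp
    have im: "\<sigma> ` ({..<N} - {i}) = {..<N} - {\<sigma> i}"
      using permutes_image[OF \<sigma>] inj_on_image_set_diff[OF permutes_inj[OF \<sigma>], of "{..<N}" "{i}"]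
      by auto
    have "swap_weight N x (\<sigma> i) = (\<Prod>j\<in>{..<N} - {i}. \<phi> i j)"
      unfolding swap_weight_def im[symmetric] \<phi>_def
      by (subst prod.reindex) (auto intro: inj_on_subset[OF permutes_inj[OF \<sigma>]])
    also have "{..<N} - {i} = {..<i} \<union> {i<..<N}"
      using iN by auto
    also have "(\<Prod>j\<in>{..<i} \<union> {i<..<N}. \<phi> i j) = (\<Prod>j<i. \<phi> i j) * (\<Prod>j\<in>{i<..<N}. \<phi> i j)"
      by (rule prod.union_disjoint) auto
    finally have w: "swap_weight N x (\<sigma> i) = \<dots>" .
    have inv: "(\<Prod>j<i. (x (\<sigma> i) - x (\<sigma> j)) / (x (\<sigma> i) + x (\<sigma> j))) * (\<Prod>j<i. \<phi> i j) = 1"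
      unfolding prod.distrib[symmetric]
    proof (rule prod.neutral, rule ballI)
      fix j assume j: "j \<in> {..<i}"
      then have "\<sigma> i < N" "\<sigma> j < N" "\<sigma> i \<noteq> \<sigma> j"
        using permutes_in_image[OF \<sigma>, of i] permutes_in_image[OF \<sigma>, of j]
          inj_eq[OF permutes_inj[OF \<sigma>], of i j] iN by auto
      then have "x (\<sigma> i) - x (\<sigma> j) \<noteq> 0 \<and> x (\<sigma> i) + x (\<sigma> j) \<noteq> 0"
        by (rule dist)
      then show "(x (\<sigma> i) - x (\<sigma> j)) / (x (\<sigma> i) + x (\<sigma> j)) * \<phi> i j = 1"
        by (simp add: \<phi>_def)
    qed
    show ?thesis
      unfolding w mult.assoc[symmetric] inv by simp
  qed
  have "schur_Q_term N lam (x \<circ> \<sigma>) =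
    (\<Prod>i<length lam. x (\<sigma> i) ^ (lam ! i)) * (\<Prod>i<length lam. \<Prod>j\<in>{i<..<N}. \<phi> i j)"
    by (simp add: schur_Q_term_def \<phi>_def)
  also have "(\<Prod>i<length lam. \<Prod>j\<in>{i<..<N}. \<phi> i j) = (\<Prod>i<length lam.
    (\<Prod>j<i. (x (\<sigma> i) - x (\<sigma> j)) / (x (\<sigma> i) + x (\<sigma> j))) * swap_weight N x (\<sigma> i))"
    by (rule prod.cong) (auto simp: split)
  finally show ?thesis
    by (simp only: prod.distrib mult_ac)
qed

text \<open>
  The antisymmetric product vanishes at functions that are not injective, so they may be added to the
  sum over injections; a sum over all functions is what factors into one-variable sums.
\<close>

lemma schur_Q_sum_functions:
  fixes x :: "nat \<Rightarrow> 'a::field"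
  assumes len: "length lam \<le> N"
    and dist: "\<And>a b. a < N \<Longrightarrow> b < N \<Longrightarrow> a \<noteq> b \<Longrightarrow> x a - x b \<noteq> 0 \<and> x a + x b \<noteq> 0"
  shows "schur_Q N lam x = 2 ^ length lam * (\<Sum>f\<in>{..<length lam} \<rightarrow>\<^sub>E {..<N}.
    (\<Prod>j<length lam. \<Prod>i<j. (x (f j) - x (f i)) / (x (f j) + x (f i))) *
    (\<Prod>i<length lam. swap_weight N x (f i) * x (f i) ^ (lam ! i)))"
proof -
  define m where "m = length lam"
  define T where "T f = (\<Prod>j<m. \<Prod>i<j. (x (f j) - x (f i)) / (x (f j) + x (f i))) *
    (\<Prod>i<m. swap_weight N x (f i) * x (f i) ^ (lam ! i))" for f
  define P where "P = {\<sigma>. \<sigma> permutes {..<N}}"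
  define c where "c \<sigma> = (\<lambda>\<tau>. \<sigma> \<circ> \<tau>) ` {\<tau>. \<tau> permutes {m..<N}}" for \<sigma> :: "nat \<Rightarrow> nat"
  define r where "r \<sigma> = restrict \<sigma> {..<m}" for \<sigma> :: "nat \<Rightarrow> nat"
  have "(\<Sum>C\<in>perm_cosets N m. the_elem ((\<lambda>\<sigma>. schur_Q_term N lam (x \<circ> \<sigma>)) ` C)) = sum T (r ` P)"
    unfolding perm_cosets_def c_def[symmetric] P_def[symmetric]
  proof (rule sum_image_same_fibres)
    fix \<sigma> \<rho> assume "\<sigma> \<in> P" "\<rho> \<in> P"
    then have "c \<sigma> = c \<rho> \<longleftrightarrow> (\<forall>i<m. \<sigma> i = \<rho> i)"
      unfolding c_def P_def by (intro coset_eq_iff) auto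
    also have "\<dots> \<longleftrightarrow> r \<sigma> = r \<rho>"
      by (auto simp: r_def fun_eq_iff restrict_def)
    finally show "c \<sigma> = c \<rho> \<longleftrightarrow> r \<sigma> = r \<rho>" .
  next
    fix \<sigma> assume \<sigma>: "\<sigma> \<in> P"
    have "c \<sigma> \<in> perm_cosets N (length lam)"
      using \<sigma> by (auto simp: perm_cosets_def c_def P_def m_def)
    moreover have "\<sigma> \<in> c \<sigma>"
      unfolding c_def by (rule image_eqI[of _ _ id]) auto
    ultimately have "the_elem ((\<lambda>\<sigma>. schur_Q_term N lam (x \<circ> \<sigma>)) ` c \<sigma>) = schur_Q_term N lam (x \<circ> \<sigma>)"
      by (rule schur_Q_term_coset)
    also have "\<dots> = T \<sigma>"
      unfolding T_def m_def using \<sigma> by (intro schur_Q_term_eq len dist) (auto simp: P_def)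
    also have "\<dots> = T (r \<sigma>)"
      unfolding T_def by (intro arg_cong2[where f = "(*)"] prod.cong refl) (auto simp: r_def)
    finally show "the_elem ((\<lambda>\<sigma>. schur_Q_term N lam (x \<circ> \<sigma>)) ` c \<sigma>) = T (r \<sigma>)" .
  qed
  also have "r ` P = {f \<in> {..<m} \<rightarrow>\<^sub>E {..<N}. inj_on f {..<m}}"
    unfolding r_def P_def by (rule restrict_permutations) (simp add: m_def len)
  also have "sum T \<dots> = sum T ({..<m} \<rightarrow>\<^sub>E {..<N})"
  proof (rule sum.mono_neutral_left)
    show "\<forall>f\<in>({..<m} \<rightarrow>\<^sub>E {..<N}) - {f \<in> {..<m} \<rightarrow>\<^sub>E {..<N}. inj_on f {..<m}}. T f = 0"
    proof
      fix f assume "f \<in> ({..<m} \<rightarrow>\<^sub>E {..<N}) - {f \<in> {..<m} \<rightarrow>\<^sub>E {..<N}. inj_on f {..<m}}"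
      then obtain i j where "i < m" "j < m" "i \<noteq> j" "f i = f j"
        by (auto simp: inj_on_def)
      then obtain i j where ij: "j < m" "i < j" "f i = f j"
        by (metis linorder_neqE_nat)
      then have "\<exists>j\<in>{..<m}. (\<Prod>i<j. (x (f j) - x (f i)) / (x (f j) + x (f i))) = 0"
        by (intro bexI[of _ j]) (auto intro!: bexI[of _ i])
      then show "T f = 0"
        by (auto simp: T_def)
    qed
  qed (auto intro: finite_PiE)
  finally show ?thesis
    unfolding schur_Q_def T_def m_def by (rule arg_cong)
qed

theorem schur_Q_even_staircase:
  fixes x :: "nat \<Rightarrow> 'a::field_char_0"
  assumes "m \<le> N"
    and dist: "\<And>a b. a < N \<Longrightarrow> b < N \<Longrightarrow> a \<noteq> b \<Longrightarrow> x a - x b \<noteq> 0 \<and> x a + x b \<noteq> 0"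
  shows "schur_Q N (map (\<lambda>i. 2 * (m - i)) [0..<m]) x =
    2 ^ m * ((\<Prod>j<m. \<Prod>i<j. - 1) *
      detf m (\<lambda>i j. \<Sum>a<N. swap_weight N x a * x a ^ (i + j + 2)))"
proof -
  let ?lam = "map (\<lambda>i. 2 * (m - i)) [0..<m]"
  have "schur_Q N ?lam x = 2 ^ length ?lam * (\<Sum>f\<in>{..<length ?lam} \<rightarrow>\<^sub>E {..<N}.
    (\<Prod>j<length ?lam. \<Prod>i<j. (x (f j) - x (f i)) / (x (f j) + x (f i))) *
    (\<Prod>i<length ?lam. swap_weight N x (f i) * x (f i) ^ (?lam ! i)))"
    by (rule schur_Q_sum_functions) (use assms in auto)
  also have "\<dots> = 2 ^ m * (\<Sum>f\<in>{..<m} \<rightarrow>\<^sub>E {..<N}.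
    (\<Prod>j<m. \<Prod>i<j. (x (f j) - x (f i)) / (x (f j) + x (f i))) *
    (\<Prod>i<m. swap_weight N x (f i) * x (f i) ^ (2 * (m - i))))"
    by simp
  also have "(\<Sum>f\<in>{..<m} \<rightarrow>\<^sub>E {..<N}.
    (\<Prod>j<m. \<Prod>i<j. (x (f j) - x (f i)) / (x (f j) + x (f i))) *
    (\<Prod>i<m. swap_weight N x (f i) * x (f i) ^ (2 * (m - i)))) =
    (\<Prod>j<m. \<Prod>i<j. - 1) * detf m (\<lambda>i j. \<Sum>a<N. swap_weight N x a * x a ^ (i + j + 2))"
  proof (rule sum_eq_hankel_det)
    fix a b assume "a \<in> {..<N}" "b \<in> {..<N}" "a \<noteq> b"
    then have "(x a - x b) * (x a + x b) \<noteq> 0"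
      using dist[of a b] by simp
    then show "(x a)\<^sup>2 \<noteq> (x b)\<^sup>2"
      by (auto simp: power2_eq_square algebra_simps)
  qed simp
  finally show ?thesis .
qed

section \<open>Contents of the staircase\<close>

text \<open>
  The left-hand product runs over the contents of the cells of the staircase with \<open>m\<close> rows. Passing
  to \<open>m + 1\<close> rows adds the diagonal strip with contents \<open>m, m - 2, \<dots>, -m\<close>, whose product is \<open>B (m + 1)\<close>.
  Two consecutive strips together contain each content from \<open>-l\<close> to \<open>l\<close> once.
\<close>

lemma staircase_square:
  fixes u :: "int \<Rightarrow> 'a::comm_ring_1"
  shows "(\<Prod>i\<in>{1..m}. \<Prod>k<i. u (int i + int k - int m))\<^sup>2 =
    (\<Prod>r<m. u (int m - 1 - 2 * int r)) * (\<Prod>l<m. u 0 * (\<Prod>t\<in>{1..l}. u (- int t) * u (int t)))"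
proof -
  define A where "A m = (\<Prod>i\<in>{1..m}. \<Prod>k<i. u (int i + int k - int m))" for m
  define B where "B m = (\<Prod>r<m. u (int m - 1 - 2 * int r))" for m
  define C where "C l = u 0 * (\<Prod>t\<in>{1..l}. u (- int t) * u (int t))" for l
  have B_Suc_Suc: "B (Suc (Suc l)) = u (- int (Suc l)) * u (int (Suc l)) * B l" for l
  proof -
    have "B (Suc (Suc l)) = u (int (Suc l)) * (\<Prod>r<Suc l. u (int l - 1 - 2 * int r))"
      unfolding B_def by (subst prod.lessThan_Suc_shift) (simp add: algebra_simps del: prod.lessThan_Suc)
    also have "(\<Prod>r<Suc l. u (int l - 1 - 2 * int r)) = B l * u (- int (Suc l))"
    proof -
      have "int l - 1 - 2 * int l = - int (Suc l)" by simp
      then show ?thesis by (simp only: B_def prod.lessThan_Suc)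
    qed
    finally show ?thesis by (simp only: mult_ac)
  qed
  have BB: "B l * B (Suc l) = C l" for l
  proof (induction l)
    case 0
    then show ?case by (simp add: B_def C_def)
  next
    case (Suc l)
    have "B (Suc l) * B (Suc (Suc l)) = u (- int (Suc l)) * u (int (Suc l)) * (B l * B (Suc l))"
      unfolding B_Suc_Suc by (simp only: mult_ac)
    also have "\<dots> = C (Suc l)"
      unfolding Suc.IH by (simp add: C_def mult_ac)
    finally show ?case .
  qed
  have A_Suc: "A (Suc m) = A m * B (Suc m)" for m
  proof -
    have "A (Suc m) = (\<Prod>i<Suc m. \<Prod>k<Suc i. u (int i + int k - int m))"
      unfolding A_def
      by (rule prod.reindex_bij_witness[where i = Suc and j = "\<lambda>i. i - 1"])
        (auto simp del: prod.lessThan_Suc intro!: prod.cong arg_cong[where f = u])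
    also have "\<dots> = (\<Prod>i<Suc m. \<Prod>k<i. u (int i + int k - int m)) * (\<Prod>i<Suc m. u (2 * int i - int m))"
      unfolding prod.lessThan_Suc[of _ "_ :: nat"] prod.distrib[symmetric] by (simp add: prod.distrib)
    also have "(\<Prod>i<Suc m. \<Prod>k<i. u (int i + int k - int m)) = A m"
      unfolding A_def by (rule prod.mono_neutral_cong_right) (auto simp: Suc_le_eq)
    also have "(\<Prod>i<Suc m. u (2 * int i - int m)) = B (Suc m)"
      unfolding B_def
      by (rule prod.reindex_bij_witness[where i = "\<lambda>r. m - r" and j = "\<lambda>r. m - r"])
        (auto simp: of_nat_diff)
    finally show ?thesis .
  qed
  have "(A m)\<^sup>2 = B m * (\<Prod>l<m. C l)"
  proof (induction m)
    case 0
    then show ?case by (simp add: A_def B_def)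
  next
    case (Suc m)
    have "(A (Suc m))\<^sup>2 = (A m)\<^sup>2 * (B (Suc m) * B (Suc m))"
      by (simp add: A_Suc power2_eq_square mult_ac)
    also have "\<dots> = (B m * B (Suc m)) * B (Suc m) * (\<Prod>l<m. C l)"
      unfolding Suc.IH by (simp only: mult_ac)
    finally show ?case
      unfolding BB by (simp add: mult_ac)
  qed
  then show ?thesis
    unfolding A_def B_def C_def .
qed

section \<open>Moments at the powers of a generic parameter\<close>

locale generic_parameter =
  fixes q :: "'a::field_char_0"
  assumes q_nonzero [simp]: "q \<noteq> 0"
    and q_power_neq_1: "k \<ge> 1 \<Longrightarrow> q ^ k \<noteq> 1"
begin

text \<open>
  In terms of the \<open>q\<close>-shifted factorial, this is \<open>(q; q)\<^sub>n\<close>.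
\<close>

definition qfac :: "nat \<Rightarrow> 'a"
  where "qfac n = (\<Prod>t\<in>{1..n}. 1 - q ^ t)"

lemma qfac_0 [simp]: "qfac 0 = 1"
  by (simp add: qfac_def)

lemma qfac_Suc: "qfac (Suc n) = qfac n * (1 - q ^ Suc n)"
  by (simp add: qfac_def)

lemma qfac_nonzero [simp]: "qfac n \<noteq> 0"
  using q_power_neq_1 by (auto simp: qfac_def)

text \<open>
  The value \<open>e\<^sub>l(1, q, \<dots>, q\<^bsup>N-1\<^esup>)\<close> of the elementary symmetric function, by lemma
  \<open>q_binomial_theorem\<close>.
\<close>

definition elementary :: "nat \<Rightarrow> nat \<Rightarrow> 'a"
  where "elementary N l = (if l \<le> N then q ^ (l choose 2) * qfac N / (qfac l * qfac (N - l)) else 0)"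

lemma elementary_Suc_Suc: "elementary (Suc N) (Suc l) = elementary N (Suc l) + q ^ N * elementary N l"
proof -
  consider "l < N" | "l = N" | "l > N" by linarith
  then show ?thesis
  proof cases
    case 1
    then obtain d where N: "N = Suc (l + d)"
      by (metis less_iff_Suc_add)
    have "Suc l choose 2 = (l choose 2) + l"
      by (simp add: numeral_2_eq_2)
    moreover have "1 - q ^ Suc l \<noteq> 0" "1 - q ^ Suc d \<noteq> 0"
      using q_power_neq_1[of "Suc l"] q_power_neq_1[of "Suc d"] by auto
    ultimately show ?thesis
      unfolding elementary_def N
      by (simp add: qfac_Suc power_add divide_simps del: power_Suc) (simp add: algebra_simps power_add)
  next
    case 2
    then show ?thesis
      by (simp add: elementary_def numeral_2_eq_2 power_add)
  next
    case 3
    then show ?thesis by (simp add: elementary_def)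
  qed
qed

lemma elementary_0: "elementary N 0 = 1"
  by (simp add: elementary_def numeral_2_eq_2)

lemma q_binomial_theorem: "(\<Prod>b<N. 1 + y * q ^ b) = (\<Sum>l\<le>N. elementary N l * y ^ l)"
proof (induction N)
  case 0
  then show ?case by (simp add: elementary_0)
next
  case (Suc N)
  have "(\<Sum>l\<le>Suc N. elementary (Suc N) l * y ^ l) =
      1 + (\<Sum>l\<le>N. (elementary N (Suc l) + q ^ N * elementary N l) * y ^ Suc l)"
    by (subst sum.atMost_Suc_shift) (simp add: elementary_0 elementary_Suc_Suc)
  also have "\<dots> = (1 + (\<Sum>l\<le>N. elementary N (Suc l) * y ^ Suc l)) + y * q ^ N * (\<Sum>l\<le>N. elementary N l * y ^ l)"
    by (simp add: algebra_simps sum.distrib sum_distrib_left)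
  also have "1 + (\<Sum>l\<le>N. elementary N (Suc l) * y ^ Suc l) = (\<Sum>l\<le>Suc N. elementary N l * y ^ l)"
    by (subst sum.atMost_Suc_shift) (simp add: elementary_0)
  also have "\<dots> = (\<Sum>l\<le>N. elementary N l * y ^ l)"
    by (simp add: elementary_def)
  finally show ?case
    by (simp add: Suc.IH algebra_simps)
qed

text \<open>
  For \<open>k \<ge> 0\<close>, the value \<open>h\<^sub>k(1, q, \<dots>, q\<^bsup>N-1\<^esup>)\<close> of the complete symmetric function. The form that
  is chosen makes sense for all integers \<open>k\<close> and vanishes for \<open>-N < k < 0\<close>, the only negative indices
  that occur together with a non-zero \<open>e\<^sub>l\<close>.
\<close>

definition complete_hom :: "nat \<Rightarrow> int \<Rightarrow> 'a"
  where "complete_hom N k = (\<Prod>t\<in>{1..<N}. 1 - q powi (k + int t)) / qfac (N - 1)"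

lemma prod_one_minus_quotients:
  assumes "a < N"
  shows "(\<Prod>b\<in>{..<N} - {a}. 1 - q ^ b / q ^ a) =
    qfac a * qfac (N - 1 - a) / ((- 1) ^ a * q ^ (Suc a choose 2))"
proof -
  have split: "{..<N} - {a} = {..<a} \<union> {a<..<N}"
    using assms by auto
  have "(\<Prod>b\<in>{..<N} - {a}. 1 - q ^ b / q ^ a) =
    (\<Prod>b<a. 1 - q ^ b / q ^ a) * (\<Prod>b\<in>{a<..<N}. 1 - q ^ b / q ^ a)"
    unfolding split by (rule prod.union_disjoint) auto
  also have "(\<Prod>b\<in>{a<..<N}. 1 - q ^ b / q ^ a) = qfac (N - 1 - a)"
    unfolding qfac_def
    by (rule prod.reindex_bij_witness[where i = "\<lambda>t. a + t" and j = "\<lambda>b. b - a"])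
      (auto simp: power_diff)
  also have "(\<Prod>b<a. 1 - q ^ b / q ^ a) = (\<Prod>t\<in>{1..a}. - (1 - q ^ t) / q ^ t)"
    by (rule prod.reindex_bij_witness[where i = "\<lambda>t. a - t" and j = "\<lambda>b. a - b"])
      (auto simp: power_diff divide_simps)
  also have "\<dots> = qfac a / ((- 1) ^ a * q ^ (Suc a choose 2))"
  proof (induction a)
    case (Suc a)
    have "Suc (Suc a) choose 2 = (Suc a choose 2) + Suc a"
      by (simp add: numeral_2_eq_2)
    then have pow: "q ^ (Suc (Suc a) choose 2) = q ^ (Suc a choose 2) * q ^ Suc a"
      by (simp only: power_add)
    have "(\<Prod>t\<in>{1..Suc a}. - (1 - q ^ t) / q ^ t) =
      (\<Prod>t\<in>{1..a}. - (1 - q ^ t) / q ^ t) * (- (1 - q ^ Suc a) / q ^ Suc a)"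
      by simp
    then show ?case
      unfolding Suc.IH qfac_Suc pow
      by simp (simp add: mult.assoc right_diff_distrib diff_divide_distrib)
  qed (simp add: numeral_2_eq_2)
  finally show ?thesis by simp
qed

text \<open>
  The partial fraction form \<open>h\<^sub>k = \<Sum>\<^sub>a x\<^sub>a\<^sup>k / \<Prod>\<^bsub>b \<noteq> a\<^esub> (1 - x\<^sub>b / x\<^sub>a)\<close>. At powers of \<open>q\<close> it is the
  \<open>q\<close>-binomial expansion with \<open>y = -q\<^bsup>k+1\<^esup>\<close>, so it holds for negative \<open>k\<close> as well.
\<close>

lemma complete_hom_eq_sum:
  assumes "N \<ge> 1"
  shows "complete_hom N k = (\<Sum>a<N. (q ^ a) powi k / (\<Prod>b\<in>{..<N} - {a}. 1 - q ^ b / q ^ a))"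
proof -
  define y where "y = - (q powi (k + 1))"
  have "(\<Prod>t\<in>{1..<N}. 1 - q powi (k + int t)) = (\<Prod>b<N - 1. 1 + y * q ^ b)"
    by (rule prod.reindex_bij_witness[where i = "\<lambda>t. t + 1" and j = "\<lambda>b. b - 1"])
      (auto simp: y_def power_int_add power_int_diff algebra_simps simp flip: power_int_of_nat)
  also have "\<dots> = (\<Sum>l\<le>N - 1. elementary (N - 1) l * y ^ l)"
    by (rule q_binomial_theorem)
  finally have "complete_hom N k = (\<Sum>l\<le>N - 1. elementary (N - 1) l * y ^ l / qfac (N - 1))"
    by (simp add: complete_hom_def sum_divide_distrib)
  also have "{..N - 1} = {..<N}"
    using assms by auto
  also have "(\<Sum>l<N. elementary (N - 1) l * y ^ l / qfac (N - 1)) =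
    (\<Sum>a<N. (q ^ a) powi k / (\<Prod>b\<in>{..<N} - {a}. 1 - q ^ b / q ^ a))"
  proof (rule sum.cong[OF refl])
    fix a assume "a \<in> {..<N}"
    then have a: "a < N" by simp
    have "Suc a choose 2 = (a choose 2) + a"
      by (simp add: numeral_2_eq_2)
    moreover have "y ^ a = (- 1) ^ a * ((q ^ a) powi k * q ^ a)"
      unfolding y_def by (subst power_minus)
        (simp add: power_int_add power_mult_distrib power_int_power power_int_power' mult.commute)
    ultimately show "elementary (N - 1) a * y ^ a / qfac (N - 1) =
      (q ^ a) powi k / (\<Prod>b\<in>{..<N} - {a}. 1 - q ^ b / q ^ a)"
      using a by (simp add: prod_one_minus_quotients elementary_def power_add)
  qed
  finally show ?thesis .
qed

definition moment :: "nat \<Rightarrow> nat \<Rightarrow> 'a"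
  where "moment N k = (\<Sum>a<N. swap_weight N (\<lambda>i. q ^ i) a * (q ^ a) ^ k)"

text \<open>
  Inserting the partial fraction form of \<open>h\<close> and summing over \<open>l\<close> first gives the generating function of
  the \<open>e\<^sub>l\<close> at \<open>s / x\<^sub>a\<close>. For \<open>s = 1\<close> the factor \<open>b = a\<close> is \<open>2\<close> and the others make up the weight
  \<open>w\<^sub>a\<close>; for \<open>s = -1\<close> the factor \<open>b = a\<close> is \<open>0\<close>.
\<close>

lemma signed_convolution:
  assumes "N \<ge> 1"
  shows "(\<Sum>l\<le>N. elementary N l * s ^ l * complete_hom N (int k - int l)) =
    (\<Sum>a<N. (q ^ a) ^ k * (\<Prod>b<N. 1 + s * (q ^ b / q ^ a)) / (\<Prod>b\<in>{..<N} - {a}. 1 - q ^ b / q ^ a))"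
proof -
  have "(\<Sum>l\<le>N. elementary N l * s ^ l * complete_hom N (int k - int l)) =
    (\<Sum>l\<le>N. \<Sum>a<N. elementary N l * s ^ l * ((q ^ a) powi (int k - int l) /
      (\<Prod>b\<in>{..<N} - {a}. 1 - q ^ b / q ^ a)))"
    by (simp add: complete_hom_eq_sum[OF assms] sum_distrib_left)
  also have "\<dots> = (\<Sum>a<N. \<Sum>l\<le>N. elementary N l * s ^ l * ((q ^ a) powi (int k - int l) /
      (\<Prod>b\<in>{..<N} - {a}. 1 - q ^ b / q ^ a)))"
    by (rule sum.swap)
  also have "\<dots> = (\<Sum>a<N. (q ^ a) ^ k * (\<Prod>b<N. 1 + s * (q ^ b / q ^ a)) /
      (\<Prod>b\<in>{..<N} - {a}. 1 - q ^ b / q ^ a))"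
  proof (rule sum.cong[OF refl])
    fix a
    have "(\<Prod>b<N. 1 + s * (q ^ b / q ^ a)) = (\<Prod>b<N. 1 + s / q ^ a * q ^ b)"
      by simp
    also have "\<dots> = (\<Sum>l\<le>N. elementary N l * (s / q ^ a) ^ l)"
      by (rule q_binomial_theorem)
    finally show "(\<Sum>l\<le>N. elementary N l * s ^ l * ((q ^ a) powi (int k - int l) /
        (\<Prod>b\<in>{..<N} - {a}. 1 - q ^ b / q ^ a))) =
      (q ^ a) ^ k * (\<Prod>b<N. 1 + s * (q ^ b / q ^ a)) / (\<Prod>b\<in>{..<N} - {a}. 1 - q ^ b / q ^ a)"
      by (simp add: sum_distrib_left sum_divide_distrib power_int_diff power_divide mult_ac)
  qed
  finally show ?thesis .
qed

lemma convolution_plus: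
  assumes "N \<ge> 1"
  shows "(\<Sum>l\<le>N. elementary N l * complete_hom N (int k - int l)) = 2 * moment N k"
proof -
  have "(\<Sum>l\<le>N. elementary N l * complete_hom N (int k - int l)) =
    (\<Sum>a<N. (q ^ a) ^ k * (\<Prod>b<N. 1 + q ^ b / q ^ a) / (\<Prod>b\<in>{..<N} - {a}. 1 - q ^ b / q ^ a))"
    using signed_convolution[OF assms, of 1 k] by simp
  also have "\<dots> = (\<Sum>a<N. 2 * (swap_weight N (\<lambda>i. q ^ i) a * (q ^ a) ^ k))"
  proof (rule sum.cong[OF refl])
    fix a assume a: "a \<in> {..<N}"
    have "(\<Prod>b<N. 1 + q ^ b / q ^ a) = 2 * (\<Prod>b\<in>{..<N} - {a}. 1 + q ^ b / q ^ a)"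
      using a by (simp add: prod.remove)
    moreover have "swap_weight N (\<lambda>i. q ^ i) a =
      (\<Prod>b\<in>{..<N} - {a}. (1 + q ^ b / q ^ a) / (1 - q ^ b / q ^ a))"
      unfolding swap_weight_def by (intro prod.cong refl) (simp add: divide_simps)
    ultimately show "(q ^ a) ^ k * (\<Prod>b<N. 1 + q ^ b / q ^ a) /
        (\<Prod>b\<in>{..<N} - {a}. 1 - q ^ b / q ^ a) =
      2 * (swap_weight N (\<lambda>i. q ^ i) a * (q ^ a) ^ k)"
      by (simp add: prod_dividef)
  qed
  finally show ?thesis
    by (simp add: moment_def sum_distrib_left)
qed

lemma convolution_minus:
  assumes "N \<ge> 1"
  shows "(\<Sum>l\<le>N. elementary N l * (- 1) ^ l * complete_hom N (int k - int l)) = 0"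
  unfolding signed_convolution[OF assms]
proof (rule sum.neutral, rule ballI)
  fix a assume "a \<in> {..<N}"
  then have "(\<Prod>b<N. 1 + - 1 * (q ^ b / q ^ a)) = 0"
    by (intro prod_zero bexI[of _ a]) auto
  then show "(q ^ a) ^ k * (\<Prod>b<N. 1 + - 1 * (q ^ b / q ^ a)) /
    (\<Prod>b\<in>{..<N} - {a}. 1 - q ^ b / q ^ a) = 0"
    by (simp only: mult_zero_right div_0)
qed

lemma moment_eq_parity_sum:
  assumes "N \<ge> 1"
  shows "moment N k = (\<Sum>l | l \<le> N \<and> even (l + p). elementary N l * complete_hom N (int k - int l))"
proof -
  have "2 * moment N k = (\<Sum>l\<le>N. elementary N l * complete_hom N (int k - int l)) +
      (- 1) ^ p * (\<Sum>l\<le>N. elementary N l * (- 1) ^ l * complete_hom N (int k - int l))"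
    by (simp add: convolution_plus[OF assms] convolution_minus[OF assms])
  also have "\<dots> = (\<Sum>l\<le>N. 2 * (if even (l + p) then elementary N l * complete_hom N (int k - int l) else 0))"
    unfolding sum_distrib_left sum.distrib[symmetric]
    by (rule sum.cong[OF refl]) auto
  also have "\<dots> = 2 * (\<Sum>l\<le>N. if even (l + p) then elementary N l * complete_hom N (int k - int l) else 0)"
    by (rule sum_distrib_left[symmetric])
  finally have "moment N k = (\<Sum>l\<le>N. if even (l + p) then elementary N l * complete_hom N (int k - int l) else 0)"
    by simp
  also have "\<dots> = (\<Sum>l | l \<le> N \<and> even (l + p). elementary N l * complete_hom N (int k - int l))"
    by (subst sum.inter_filter[symmetric]) (auto intro: sum.cong)
  finally show ?thesis .
qed

lemma complete_hom_eq_0: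
  assumes "k < 0" "k > - int N"
  shows "complete_hom N k = 0"
proof -
  have "(\<Prod>t\<in>{1..<N}. 1 - q powi (k + int t)) = 0"
    by (rule prod_zero) (use assms in \<open>auto intro!: bexI[of _ "nat (- k)"]\<close>)
  then show ?thesis by (simp add: complete_hom_def)
qed

definition elementary_int :: "nat \<Rightarrow> int \<Rightarrow> 'a"
  where "elementary_int N k = (if k < 0 then 0 else elementary N (nat k))"

text \<open>
  The summation index is \<open>l = i + 2 r + 2 - m\<close>. Below this range the index of \<open>e\<close> is negative, and above
  it the index \<open>i + j + 2 - l\<close> of \<open>h\<close> is negative; because of \<open>l \<le> N\<close> it is then still larger than
  \<open>-N\<close>.
\<close>

lemma moment_factorization:
  assumes "N \<ge> 1" "i < m" "j < m"
  shows "moment N (i + j + 2) =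
    (\<Sum>r<m. elementary_int N (int i + 2 * int r + 2 - int m) * complete_hom N (int j - 2 * int r + int m))"
proof -
  let ?f = "\<lambda>l. elementary_int N l * complete_hom N (int (i + j + 2) - l)"
  let ?A = "{l. 0 \<le> l \<and> l \<le> int N \<and> even (l + int (i + m))}"
  let ?B = "(\<lambda>r. int i + 2 * int r + 2 - int m) ` {..<m}"
  have "moment N (i + j + 2) =
    (\<Sum>l | l \<le> N \<and> even (l + (i + m)). elementary N l * complete_hom N (int (i + j + 2) - int l))"
    by (rule moment_eq_parity_sum[OF assms(1)])
  also have "\<dots> = sum ?f ?A"
    by (rule sum.reindex_bij_witness[where i = nat and j = int])
      (auto simp: elementary_int_def even_nat_iff nat_add_distrib)
  also have "\<dots> = sum ?f ?B"
  proof (rule sum.mono_neutral_cong)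
    show "finite ?A"
      by (rule finite_subset[of _ "{0..int N}"]) auto
    show "?f l = 0" if "l \<in> ?B - ?A" for l
    proof -
      have "l \<in> ?B" using that by blast
      then obtain r where r: "r < m" "l = int i + 2 * int r + 2 - int m"
        by (elim imageE) simp
      have "l < 0 \<or> l > int N"
        using that r by auto
      then show ?thesis
        by (auto simp: elementary_int_def elementary_def)
    qed
    show "?f l = 0" if "l \<in> ?A - ?B" for l
    proof -
      have l: "0 \<le> l" "l \<le> int N" "even (l - int i + int m)"
        using that by auto
      then obtain d where "l - int i + int m = 2 * d"
        by (elim evenE)
      then have d: "l = int i - int m + 2 * d"
        by linarith
      have "\<not> (1 \<le> d \<and> d \<le> int m)"
      proof
        assume "1 \<le> d \<and> d \<le> int m"
        then have "l \<in> ?B"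
          by (intro image_eqI[of _ _ "nat (d - 1)"]) (auto simp: d)
        then show False using that by blast
      qed
      moreover have "d \<ge> 1"
        using l(1) d assms(2) by linarith
      ultimately have "d > int m" by linarith
      then have "complete_hom N (int (i + j + 2) - l) = 0"
        using l d assms(3) by (intro complete_hom_eq_0) auto
      then show ?thesis by simp
    qed
  qed auto
  also have "\<dots> = (\<Sum>r<m. ?f (int i + 2 * int r + 2 - int m))"
    by (subst sum.reindex) (auto simp: inj_on_def)
  also have "\<dots> = (\<Sum>r<m. elementary_int N (int i + 2 * int r + 2 - int m) *
      complete_hom N (int j - 2 * int r + int m))"
    by (intro sum.cong refl arg_cong2[where f = "(*)"] arg_cong[where f = "complete_hom N"]) auto
  finally show ?thesis .
qed

section \<open>Interpolation polynomials and the two determinants\<close>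

lemma prod_eq_qfac_quotient:
  assumes "a \<le> b"
  shows "(\<Prod>t\<in>{a<..b}. 1 - q ^ t) = qfac b / qfac a"
proof -
  have "{1..b} = {1..a} \<union> {a<..b}" using assms by auto
  then have "qfac b = qfac a * (\<Prod>t\<in>{a<..b}. 1 - q ^ t)"
    unfolding qfac_def by (simp only:) (rule prod.union_disjoint, auto)
  then show ?thesis by simp
qed

text \<open>
  Polynomials of degree at most \<open>m - 1\<close> whose first product has the zeros \<open>q^-(j + 2), \<dots>, q^-m\<close>: each one has a zero
  at those of the points \<open>q^-1, \<dots>, q^-m\<close> that come after its own.
\<close>

definition interp :: "nat \<Rightarrow> 'a \<Rightarrow> nat \<Rightarrow> 'a poly"
  where "interp m z j = (\<Prod>s\<in>{Suc j<..m}. [:1, - (q ^ s):]) * (\<Prod>s\<in>{1..j}. [:1, - (z * q ^ s):])"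

lemma poly_interp:
  "poly (interp m z j) X = (\<Prod>s\<in>{Suc j<..m}. 1 - q ^ s * X) * (\<Prod>s\<in>{1..j}. 1 - z * q ^ s * X)"
  by (simp add: interp_def poly_prod mult.commute)

lemma degree_interp:
  assumes "j < m"
  shows "degree (interp m z j) < m"
proof -
  have lin: "degree (\<Prod>s\<in>S. [:1, - (f s):]) \<le> card S" if "finite S" for S :: "nat set" and f :: "nat \<Rightarrow> 'a"
  proof -
    have "degree (\<Prod>s\<in>S. [:1, - (f s):]) \<le> sum (degree \<circ> (\<lambda>s. [:1, - (f s):])) S"
      by (rule degree_prod_sum_le[OF that])
    also have "\<dots> \<le> (\<Sum>s\<in>S. 1)"
      by (rule sum_mono) (simp only: o_def degree_pCons_le[THEN order_trans] degree_pCons_eq_if, simp)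
    finally show ?thesis by simp
  qed
  have "degree (interp m z j) \<le> degree (\<Prod>s\<in>{Suc j<..m}. [:1, - (q ^ s):]) +
      degree (\<Prod>s\<in>{1..j}. [:1, - (z * q ^ s):])"
    unfolding interp_def by (rule degree_mult_le)
  also have "\<dots> \<le> card {Suc j<..m} + card {1..j}"
    by (intro add_mono lin[of _ "\<lambda>s. q ^ s"] lin[of _ "\<lambda>s. z * q ^ s"]) auto
  finally show ?thesis using assms by simp
qed

lemma interp_det:
  "detf m (\<lambda>r j. poly (interp m z j) (X r)) * vandermonde m (\<lambda>i. q powi - int (Suc i)) =
    vandermonde m X * (\<Prod>i<m. qfac (m - 1 - i) * (\<Prod>t\<in>{1..i}. 1 - z * q powi - int t))"
proof -
  let ?y = "\<lambda>i. q powi - int (Suc i)"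
  have node: "q ^ s * ?y i = q powi (int s - int (Suc i))" for s i
    unfolding diff_conv_add_uminus power_int_add[OF disjI1[OF q_nonzero]] by simp
  have "detf m (\<lambda>r j. poly (interp m z j) (?y r)) = detf m (\<lambda>j r. poly (interp m z j) (?y r))"
    by (rule detf_transpose)
  also have "\<dots> = (\<Prod>i<m. poly (interp m z i) (?y i))"
  proof (rule detf_lower_triangular)
    fix i j assume "i < j" "j < m"
    then have "\<exists>s\<in>{Suc i<..m}. 1 - q ^ s * ?y j = 0"
      unfolding node by (intro bexI[of _ "Suc j"]) auto
    then have "(\<Prod>s\<in>{Suc i<..m}. 1 - q ^ s * ?y j) = 0"
      by (intro prod_zero) auto
    then show "poly (interp m z i) (?y j) = 0"
      unfolding poly_interp by (simp only: mult_zero_left)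
  qed
  also have "\<dots> = (\<Prod>i<m. qfac (m - 1 - i) * (\<Prod>t\<in>{1..i}. 1 - z * q powi - int t))"
  proof (rule prod.cong[OF refl])
    fix i assume "i \<in> {..<m}"
    have "(\<Prod>s\<in>{Suc i<..m}. 1 - q ^ s * ?y i) = qfac (m - 1 - i)"
      unfolding qfac_def node
      by (rule prod.reindex_bij_witness[where i = "\<lambda>t. t + Suc i" and j = "\<lambda>s. s - Suc i"])
        (auto simp flip: power_int_of_nat)
    moreover have "(\<Prod>s\<in>{1..i}. 1 - z * q ^ s * ?y i) = (\<Prod>t\<in>{1..i}. 1 - z * q powi - int t)"
      unfolding mult.assoc node
      by (rule prod.reindex_bij_witness[where i = "\<lambda>t. Suc i - t" and j = "\<lambda>s. Suc i - s"])
        (auto simp: of_nat_diff)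
    ultimately show "poly (interp m z i) (?y i) =
      qfac (m - 1 - i) * (\<Prod>t\<in>{1..i}. 1 - z * q powi - int t)"
      unfolding poly_interp by (simp only:)
  qed
  finally have y: "detf m (\<lambda>r j. poly (interp m z j) (?y r)) = \<dots>" .
  have "detf m (\<lambda>r j. poly (interp m z j) (X r)) * vandermonde m ?y =
      detf m (\<lambda>r j. poly (interp m z j) (?y r)) * vandermonde m X"
    by (rule detf_poly) (rule degree_interp)
  then show ?thesis
    unfolding y by (simp only: mult.commute)
qed

definition complete_row :: "nat \<Rightarrow> nat \<Rightarrow> nat \<Rightarrow> 'a"
  where "complete_row N m r = qfac (N + m - 1 - 2 * r) / (qfac (N - 1) * qfac (2 * m - 1 - 2 * r))"

text \<open>
  The product for \<open>h\<close> runs over \<open>j + 2 \<le> s \<le> N + j\<close>. The part \<open>m < s \<le> N\<close> depends on the row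
  only, and the two ends are the two products of the interpolation polynomial at \<open>z = q\<^sup>N\<close>.
\<close>

lemma complete_entry:
  assumes "m \<le> N" "r < m" "j < m"
  shows "complete_hom N (int j - 2 * int r + int m) =
    complete_row N m r * poly (interp m (q ^ N) j) (q powi (int m - 1 - 2 * int r))"
proof -
  define X where "X = q powi (int m - 1 - 2 * int r)"
  define u where "u s = 1 - q powi (int s + (int m - 1 - 2 * int r))" for s
  have u: "u s = 1 - q ^ s * X" for s
    by (simp add: u_def X_def power_int_add[OF disjI1[OF q_nonzero]])
  have "(\<Prod>t\<in>{1..<N}. 1 - q powi (int j - 2 * int r + int m + int t)) = (\<Prod>s\<in>{Suc j<..N + j}. u s)"
    by (rule prod.reindex_bij_witness[where i = "\<lambda>s. s - Suc j" and j = "\<lambda>t. t + Suc j"])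
      (auto simp: u_def algebra_simps)
  also have "{Suc j<..N + j} = {Suc j<..m} \<union> ({m<..N} \<union> {N<..N + j})"
    using assms by auto
  also have "prod u \<dots> = prod u {Suc j<..m} * prod u ({m<..N} \<union> {N<..N + j})"
    using assms by (intro prod.union_disjoint) auto
  also have "prod u ({m<..N} \<union> {N<..N + j}) = prod u {m<..N} * prod u {N<..N + j}"
    by (intro prod.union_disjoint) auto
  also have "prod u {m<..N} = (\<Prod>t\<in>{2 * m - 1 - 2 * r<..N + m - 1 - 2 * r}. 1 - q ^ t)"
    by (rule prod.reindex_bij_witness[where i = "\<lambda>t. t + 2 * r + 1 - m" and j = "\<lambda>s. s + m - 1 - 2 * r"])
      (use assms in \<open>auto simp: u_def of_nat_diff algebra_simps simp flip: power_int_of_nat\<close>)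
  also have "\<dots> = qfac (N + m - 1 - 2 * r) / qfac (2 * m - 1 - 2 * r)"
    using assms by (intro prod_eq_qfac_quotient) auto
  also have "prod u {N<..N + j} = (\<Prod>s\<in>{1..j}. 1 - q ^ N * q ^ s * X)"
    by (rule prod.reindex_bij_witness[where i = "\<lambda>s. s + N" and j = "\<lambda>s. s - N"])
      (auto simp: u simp flip: power_add)
  finally have "complete_hom N (int j - 2 * int r + int m) = prod u {Suc j<..m} *
    (qfac (N + m - 1 - 2 * r) / qfac (2 * m - 1 - 2 * r) *
      (\<Prod>s\<in>{1..j}. 1 - q ^ N * q ^ s * X)) / qfac (N - 1)"
    unfolding complete_hom_def by (rule arg_cong)
  then show ?thesis
    unfolding poly_interp X_def[symmetric] u complete_row_def by (simp add: mult_ac)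
qed

text \<open>
  The exponent is \<open>c (c + 1) / 2\<close> for \<open>c = 2 r + 1 - m\<close>; the division is exact.
\<close>

definition elem_row :: "nat \<Rightarrow> nat \<Rightarrow> nat \<Rightarrow> 'a"
  where "elem_row N m r = q powi ((2 * int r + 1 - int m) * (2 * int r + 2 - int m) div 2) *
    qfac N / (qfac (2 * r + 1) * qfac (N + m - 2 - 2 * r))"

definition elem_col :: "nat \<Rightarrow> nat \<Rightarrow> 'a"
  where "elem_col N i = q ^ (Suc i choose 2) * (\<Prod>t\<in>{1..i}. - (q ^ N / q ^ t))"

lemma two_choose_two: "2 * int (n choose 2) = int n * (int n - 1)"
proof (induction n)
  case (Suc n)
  have "Suc n choose 2 = (n choose 2) + n"
    by (simp add: numeral_2_eq_2)
  then show ?case using Suc.IH by (simp add: algebra_simps)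
qed (simp add: numeral_2_eq_2)

text \<open>
  With \<open>c = 2 r + 1 - m\<close>, the index of \<open>e\<close> is \<open>i + 1 + c\<close>. Extending the two denominators \<open>(q; q)\<^sub>k\<close>
  and \<open>(q; q)\<^bsub>N-k\<^esub>\<close> to lengths that depend on the row only gives the two products of the interpolation
  polynomial, now at \<open>z = q\<^bsup>-N\<^esup>\<close>. These products vanish by themselves where \<open>k\<close> is outside
  \<open>0, \<dots>, N\<close>.
\<close>

lemma elem_entry:
  assumes "m \<le> N" "r < m" "i < m"
  shows "elementary_int N (int i + 2 * int r + 2 - int m) =
    elem_row N m r * elem_col N i * poly (interp m (1 / q ^ N) i) (q powi (2 * int r + 1 - int m))"
proof -
  define c where "c = 2 * int r + 1 - int m"
  define k where "k = int i + 1 + c"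
  define A where "A = (\<Prod>s\<in>{Suc i<..m}. 1 - q powi (int s + c))"
  define B where "B = (\<Prod>t\<in>{1..i}. 1 - q powi (int N - c - int t))"
  have c_bounds: "1 - int m \<le> c" "c \<le> int m - 1"
    using assms by (auto simp: c_def)
  have A: "(\<Prod>s\<in>{Suc i<..m}. 1 - q ^ s * q powi c) = A"
    by (simp add: A_def power_int_add)
  have "(\<Prod>t\<in>{1..i}. - (q ^ N / q ^ t)) * (\<Prod>s\<in>{1..i}. 1 - 1 / q ^ N * q ^ s * q powi c) =
    (\<Prod>t\<in>{1..i}. q powi c * (1 - q powi (int N - c - int t)))"
    unfolding prod.distrib[symmetric]
    by (intro prod.cong refl) (simp add: power_int_diff power_int_add field_simps)
  also have "\<dots> = q powi (c * int i) * B"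
    by (simp add: prod.distrib B_def power_int_power')
  finally have B: "(\<Prod>t\<in>{1..i}. - (q ^ N / q ^ t)) *
    (\<Prod>s\<in>{1..i}. 1 - 1 / q ^ N * q ^ s * q powi c) = q powi (c * int i) * B" .
  have rhs: "elem_row N m r * elem_col N i * poly (interp m (1 / q ^ N) i) (q powi c) =
    elem_row N m r * q ^ (Suc i choose 2) * q powi (c * int i) * A * B"
    unfolding poly_interp elem_col_def A using B by (simp add: mult_ac)
  have "elementary_int N k = elem_row N m r * q ^ (Suc i choose 2) * q powi (c * int i) * A * B"
  proof -
    consider "k < 0" | "k > int N" | "0 \<le> k" "k \<le> int N" by linarith
    then show ?thesis
    proof cases
      case 1
      then have "A = 0"
        unfolding A_def using c_bounds
        by (intro prod_zero) (auto simp: k_def intro!: bexI[of _ "nat (- c)"])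
      then show ?thesis using 1 by (simp add: elementary_int_def)
    next
      case 2
      then have "B = 0"
        unfolding B_def using c_bounds assms
        by (intro prod_zero) (auto simp: k_def intro!: bexI[of _ "nat (int N - c)"])
      then show ?thesis using 2 by (simp add: elementary_int_def elementary_def)
    next
      case 3
      define n where "n = nat k"
      have n: "int n = int i + 1 + c" "n \<le> N"
        using 3 by (auto simp: n_def k_def)
      have le: "n \<le> 2 * r + 1" "N - n \<le> N + m - 2 - 2 * r"
        using n assms by (auto simp: c_def)
      have "A = (\<Prod>t\<in>{n<..2 * r + 1}. 1 - q ^ t)"
        unfolding A_def
        by (rule prod.reindex_bij_witness[where i = "\<lambda>t. nat (int t - c)" and j = "\<lambda>s. nat (int s + c)"])
          (use n assms c_bounds in \<open>auto simp: c_def simp flip: power_int_of_nat\<close>)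
      also have "\<dots> = qfac (2 * r + 1) / qfac n"
        by (rule prod_eq_qfac_quotient[OF le(1)])
      finally have A': "A = qfac (2 * r + 1) / qfac n" .
      have "B = (\<Prod>t\<in>{N - n<..N + m - 2 - 2 * r}. 1 - q ^ t)"
        unfolding B_def
        by (rule prod.reindex_bij_witness[where i = "\<lambda>t. nat (int N - c - int t)"
              and j = "\<lambda>s. nat (int N - c - int s)"])
          (use n assms c_bounds in \<open>auto simp: c_def simp flip: power_int_of_nat\<close>)
      also have "\<dots> = qfac (N + m - 2 - 2 * r) / qfac (N - n)"
        by (rule prod_eq_qfac_quotient[OF le(2)])
      finally have B': "B = qfac (N + m - 2 - 2 * r) / qfac (N - n)" .
      have "even (c * (c + 1))"
        by simp
      then have "2 * (c * (c + 1) div 2) = c * (c + 1)"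
        by (rule dvd_mult_div_cancel)
      then have "2 * int (n choose 2) = 2 * (c * (c + 1) div 2 + int (Suc i choose 2) + c * int i)"
        using two_choose_two[of n] two_choose_two[of "Suc i"] n(1) by (simp add: algebra_simps)
      then have "int (n choose 2) = c * (c + 1) div 2 + int (Suc i choose 2) + c * int i"
        by simp
      then have "q ^ (n choose 2) = q powi (c * (c + 1) div 2) * q ^ (Suc i choose 2) * q powi (c * int i)"
        by (simp add: power_int_add flip: power_int_of_nat)
      moreover have "elementary_int N k = elementary N n"
        using 3 by (simp add: elementary_int_def n_def)
      moreover have "elem_row N m r = q powi (c * (c + 1) div 2) *
        qfac N / (qfac (2 * r + 1) * qfac (N + m - 2 - 2 * r))"
      proof -
        have "c + 1 = 2 * int r + 2 - int m"
          by (simp add: c_def)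
        then show ?thesis
          by (simp only: elem_row_def c_def)
      qed
      ultimately show ?thesis
        using n(2) by (simp add: elementary_def A' B')
    qed
  qed
  then have "elementary_int N k =
    elem_row N m r * elem_col N i * poly (interp m (1 / q ^ N) i) (q powi c)"
    unfolding rhs .
  moreover have "k = int i + 2 * int r + 2 - int m"
    by (simp add: k_def c_def)
  ultimately show ?thesis
    by (simp only: c_def)
qed

lemma moment_det_eq:
  assumes "m \<le> N" "N \<ge> 1"
  shows "detf m (\<lambda>i j. moment N (i + j + 2)) =
    (\<Prod>r<m. elem_row N m r) * (\<Prod>i<m. elem_col N i) *
      detf m (\<lambda>r i. poly (interp m (1 / q ^ N) i) (q powi (2 * int r + 1 - int m))) *
    ((\<Prod>r<m. complete_row N m r) *
      detf m (\<lambda>r j. poly (interp m (q ^ N) j) (q powi (int m - 1 - 2 * int r))))"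
proof -
  let ?e = "\<lambda>i r. elementary_int N (int i + 2 * int r + 2 - int m)"
  let ?h = "\<lambda>r j. complete_hom N (int j - 2 * int r + int m)"
  have "detf m (\<lambda>i j. moment N (i + j + 2)) = detf m (\<lambda>i j. \<Sum>r<m. ?e i r * ?h r j)"
    by (rule detf_cong) (rule moment_factorization[OF assms(2)])
  also have "\<dots> = detf m (\<lambda>r i. ?e i r) * detf m ?h"
    unfolding detf_mult by (rule arg_cong2[where f = "(*)"]) (rule detf_transpose[symmetric], rule refl)
  also have "detf m (\<lambda>r i. ?e i r) = detf m (\<lambda>r i. elem_row N m r * elem_col N i *
      poly (interp m (1 / q ^ N) i) (q powi (2 * int r + 1 - int m)))"
    by (rule detf_cong) (rule elem_entry[OF assms(1)])
  also have "\<dots> = (\<Prod>r<m. elem_row N m r) * (\<Prod>i<m. elem_col N i) *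
      detf m (\<lambda>r i. poly (interp m (1 / q ^ N) i) (q powi (2 * int r + 1 - int m)))"
    by (rule detf_scale)
  also have "detf m ?h = detf m (\<lambda>r j. complete_row N m r * 1 *
      poly (interp m (q ^ N) j) (q powi (int m - 1 - 2 * int r)))"
    by (rule detf_cong) (simp add: complete_entry[OF assms(1)])
  also have "\<dots> = (\<Prod>r<m. complete_row N m r) *
      detf m (\<lambda>r j. poly (interp m (q ^ N) j) (q powi (int m - 1 - 2 * int r)))"
    unfolding detf_scale by simp
  finally show ?thesis .
qed

section \<open>Evaluation\<close>

lemma q_power_inj: "q ^ a = q ^ b \<Longrightarrow> a = b"
proof (rule ccontr)
  have less: "q ^ a \<noteq> q ^ b" if "a < b" for a b
  proof -
    have "q ^ b = q ^ a * q ^ (b - a)"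
      using that by (simp flip: power_add)
    then show ?thesis
      using q_power_neq_1[of "b - a"] that by simp
  qed
  assume "q ^ a = q ^ b" "a \<noteq> b"
  then show False
    using less[of a b] less[of b a] by (metis linorder_neqE_nat)
qed

lemma vandermonde_nodes_nonzero: "vandermonde m (\<lambda>i. q powi - int (Suc i)) \<noteq> 0"
proof -
  have "q powi - int (Suc j) \<noteq> q powi - int (Suc i)" if "i < j" for i j
  proof
    assume "q powi - int (Suc j) = q powi - int (Suc i)"
    then have "q ^ Suc j = q ^ Suc i"
      by (simp only: power_int_minus power_int_of_nat inverse_eq_iff_eq)
    then show False
      using q_power_inj that by blast
  qed
  then show ?thesis
    by (auto simp: vandermonde_eq_0)
qed

lemma prod_choose_2: "(\<Prod>i<m. q ^ (Suc i choose 2)) = q ^ (Suc m choose 3)"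
proof (induction m)
  case (Suc m)
  have "Suc (Suc m) choose 3 = (Suc m choose 3) + (Suc m choose 2)"
    by (simp add: numeral_3_eq_3 numeral_2_eq_2)
  then show ?case using Suc.IH by (simp add: power_add)
qed (simp add: numeral_3_eq_3)

text \<open>
  In the product of the two Vandermonde factors for the pair \<open>i < j\<close>, only \<open>d = j - i\<close> survives:
  \<open>-(q\<^sup>2\<^sup>d - 1) (q\<^sup>-\<^sup>2\<^sup>d - 1) = q\<^sup>-\<^sup>2\<^sup>d (1 - q\<^sup>2\<^sup>d)\<^sup>2\<close>. The sign from the Hankel determinant makes it a
  square.
\<close>

lemma vandermonde_quotient:
  "(\<Prod>j<m. \<Prod>i<j. - 1) * vandermonde m (\<lambda>r. q powi (2 * int r + 1 - int m)) *
      vandermonde m (\<lambda>r. q powi (int m - 1 - 2 * int r)) =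
    q ^ (2 * (Suc m choose 3)) * (\<Prod>j<m. \<Prod>i<j. 1 + q ^ (j - i))\<^sup>2 *
      (vandermonde m (\<lambda>i. q powi - int (Suc i)))\<^sup>2"
proof -
  have inner: "(\<Prod>i<j. q ^ (2 * Suc i)) = (q ^ (Suc j choose 2))\<^sup>2" for j
  proof (induction j)
    case (Suc j)
    have "Suc (Suc j) choose 2 = (Suc j choose 2) + Suc j"
      by (simp add: numeral_2_eq_2)
    then have "q ^ (Suc (Suc j) choose 2) = q ^ (Suc j choose 2) * q ^ Suc j"
      by (simp only: power_add)
    moreover have "q ^ (2 * Suc j) = (q ^ Suc j)\<^sup>2"
      by (simp only: mult.commute[of 2] power_mult)
    ultimately show ?case
      by (simp only: prod.lessThan_Suc Suc.IH power_mult_distrib)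
  qed (simp add: numeral_2_eq_2)
  have pow: "q ^ (2 * (Suc m choose 3)) = (\<Prod>j<m. \<Prod>i<j. q ^ (2 * Suc i))"
    unfolding inner prod_power_distrib[symmetric] prod_choose_2 by (simp add: mult.commute flip: power_mult)
  have pair: "- 1 * (q powi (2 * int j + 1 - int m) - q powi (2 * int i + 1 - int m)) *
      (q powi (int m - 1 - 2 * int j) - q powi (int m - 1 - 2 * int i)) =
    q ^ (2 * Suc i) * (1 + q ^ (j - i))\<^sup>2 * (q powi - int (Suc j) - q powi - int (Suc i))\<^sup>2"
    if "i < j" for i j
  proof -
    define d where "d = j - i"
    have j: "j = i + d"
      using that by (simp add: d_def)
    define M where "M = q powi (int m - 1)"
    have M: "M \<noteq> 0" by (simp add: M_def)
    have e1: "q powi (2 * int r + 1 - int m) = q ^ r * q ^ r / M" for r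
    proof -
      have "q powi (2 * int r + 1 - int m) = q powi (int r + int r - (int m - 1))"
        by (simp add: algebra_simps)
      then show ?thesis
        by (simp only: M_def power_int_add[OF disjI1[OF q_nonzero]]
            power_int_diff[OF disjI1[OF q_nonzero]] power_int_of_nat)
    qed
    have e2: "q powi (int m - 1 - 2 * int r) = M / (q ^ r * q ^ r)" for r
    proof -
      have "q powi (int m - 1 - 2 * int r) = q powi ((int m - 1) - (int r + int r))"
        by (simp add: algebra_simps)
      then show ?thesis
        by (simp only: M_def power_int_add[OF disjI1[OF q_nonzero]]
            power_int_diff[OF disjI1[OF q_nonzero]] power_int_of_nat)
    qed
    have e3: "q powi - int (Suc r) = 1 / (q * q ^ r)" for r
      by (simp only: power_int_minus power_int_of_nat power_Suc inverse_eq_divide)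
    define a where "a = q ^ i"
    define b where "b = q ^ d"
    have ab: "a \<noteq> 0" "b \<noteq> 0" by (simp_all add: a_def b_def)
    have "q ^ j = a * b" "q ^ (2 * Suc i) = q * q * a * a" "q ^ (j - i) = b"
      by (simp_all add: a_def b_def j power_add mult_2)
    then show ?thesis
      unfolding e1 e2 e3 a_def[symmetric] using M ab
      by (simp add: field_simps power2_eq_square)
  qed
  have "(\<Prod>j<m. \<Prod>i<j. - 1) * vandermonde m (\<lambda>r. q powi (2 * int r + 1 - int m)) *
      vandermonde m (\<lambda>r. q powi (int m - 1 - 2 * int r)) =
    (\<Prod>j<m. \<Prod>i<j. - 1 * (q powi (2 * int j + 1 - int m) - q powi (2 * int i + 1 - int m)) *
      (q powi (int m - 1 - 2 * int j) - q powi (int m - 1 - 2 * int i)))"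
    unfolding vandermonde_def prod.distrib ..
  also have "\<dots> = (\<Prod>j<m. \<Prod>i<j. q ^ (2 * Suc i) * (1 + q ^ (j - i))\<^sup>2 *
      (q powi - int (Suc j) - q powi - int (Suc i))\<^sup>2)"
    by (intro prod.cong refl pair) simp
  also have "\<dots> = q ^ (2 * (Suc m choose 3)) * (\<Prod>j<m. \<Prod>i<j. 1 + q ^ (j - i))\<^sup>2 *
      (vandermonde m (\<lambda>i. q powi - int (Suc i)))\<^sup>2"
    unfolding pow vandermonde_def prod.distrib prod_power_distrib ..
  finally show ?thesis .
qed

text \<open>
  Separating odd and even exponents, \<open>(q; q)\<^bsub>2j+1\<^esub> = (q; q\<^sup>2)\<^bsub>j+1\<^esub> (q\<^sup>2; q\<^sup>2)\<^sub>j\<close>, and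
  \<open>(q\<^sup>2; q\<^sup>2)\<^sub>j = (-q; q)\<^sub>j (q; q)\<^sub>j\<close>.
\<close>

lemma odd_qfac_factorization:
  "(\<Prod>j<m. \<Prod>i<j. 1 + q ^ (j - i)) * (\<Prod>i<m. qfac (m - 1 - i)) * (\<Prod>i<m. qpoch q (q\<^sup>2) (Suc i)) =
    (\<Prod>r<m. qfac (2 * r + 1))"
proof -
  have one: "(\<Prod>t\<in>{1..j}. 1 + q ^ t) * qfac j * qpoch q (q\<^sup>2) (Suc j) = qfac (2 * j + 1)" for j
  proof (induction j)
    case 0
    then show ?case by (simp add: qfac_def qpoch_def)
  next
    case (Suc j)
    define a where "a = q ^ Suc j"
    have a: "q * (q\<^sup>2) ^ Suc j = q * (a * a)" "q ^ Suc (2 * j + 1) = a * a" "q ^ Suc (Suc (2 * j + 1)) = q * (a * a)"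
      by (simp_all add: a_def power2_eq_square mult_2 power_add power_mult_distrib)
    have "(\<Prod>t\<in>{1..Suc j}. 1 + q ^ t) * qfac (Suc j) * qpoch q (q\<^sup>2) (Suc (Suc j)) =
      ((\<Prod>t\<in>{1..j}. 1 + q ^ t) * qfac j * qpoch q (q\<^sup>2) (Suc j)) *
        ((1 + a) * (1 - a) * (1 - q * (q\<^sup>2) ^ Suc j))"
      by (simp add: qpoch_def qfac_Suc a_def mult_ac)
    also have "\<dots> = qfac (2 * j + 1) * (1 - q ^ Suc (2 * j + 1)) * (1 - q ^ Suc (Suc (2 * j + 1)))"
      unfolding Suc.IH a by (simp add: algebra_simps)
    also have "\<dots> = qfac (2 * Suc j + 1)"
      by (simp add: qfac_Suc)
    finally show ?case .
  qed
  have rev: "(\<Prod>i<j. 1 + q ^ (j - i)) = (\<Prod>t\<in>{1..j}. 1 + q ^ t)" for j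
    by (rule prod.reindex_bij_witness[where i = "\<lambda>t. j - t" and j = "\<lambda>i. j - i"]) auto
  have rev': "(\<Prod>i<m. qfac (m - 1 - i)) = (\<Prod>i<m. qfac i)"
    using prod.nat_diff_reindex[of qfac m] by simp
  show ?thesis
    unfolding rev rev' prod.distrib[symmetric] one ..
qed

text \<open>
  Consecutive factorials meet in the row factors of \<open>e\<close> and \<open>h\<close> and leave one linear factor each. The exponents
  are the triangular numbers \<open>c (c + 1) / 2\<close> for \<open>c = 1 - m, 3 - m, \<dots>, m - 1\<close>.
\<close>

lemma prod_rows:
  assumes "m \<le> N" "N \<ge> 1"
  shows "(\<Prod>r<m. elem_row N m r) * (\<Prod>r<m. complete_row N m r) =
    q ^ (Suc m choose 3) * (\<Prod>r<m. 1 - q powi (int N + (int m - 1 - 2 * int r))) * (1 - q ^ N) ^ m /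
      (\<Prod>r<m. qfac (2 * r + 1))\<^sup>2"
proof -
  define T where "T r = (2 * int r + 1 - int m) * (2 * int r + 2 - int m) div 2" for r
  have T2: "2 * T r = (2 * int r + 1 - int m) * (2 * int r + 2 - int m)" for r
  proof -
    have "even ((2 * int r + 1 - int m) * (2 * int r + 2 - int m))"
      by simp
    then show ?thesis
      unfolding T_def by (rule dvd_mult_div_cancel)
  qed
  have "(\<Prod>r<k. q powi T r) = q powi (\<Sum>r<k. T r)" for k
    by (induction k) (simp_all add: power_int_add)
  moreover have "(\<Sum>r<m. T r) = int (Suc m choose 3)"
  proof -
    \<comment> \<open>Induction needs a number of terms that is independent of the shift \<open>m\<close>.\<close>
    have sum_T: "6 * (\<Sum>r<k. T r) = int k * (4 * int k ^ 2 - 1 - 6 * int k * int m + 3 * int k + 3 * int m ^ 2 - 3 * int m)" for k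
    proof (induction k)
      case (Suc k)
      have "6 * (\<Sum>r<Suc k. T r) = 6 * (\<Sum>r<k. T r) + 3 * (2 * T k)"
        by simp
      then show ?case
        unfolding Suc.IH T2 by (simp add: algebra_simps power2_eq_square)
    qed simp
    have choose: "6 * int (Suc k choose 3) = (int k + 1) * int k * (int k - 1)" for k
    proof (induction k)
      case (Suc k)
      have "Suc (Suc k) choose 3 = (Suc k choose 3) + (Suc k choose 2)"
        by (simp add: numeral_3_eq_3 numeral_2_eq_2)
      then have "6 * int (Suc (Suc k) choose 3) = 6 * int (Suc k choose 3) + 3 * (2 * int (Suc k choose 2))"
        by simp
      then show ?case
        unfolding Suc.IH two_choose_two by (simp add: algebra_simps)
    qed (simp add: numeral_3_eq_3)
    have "6 * (\<Sum>r<m. T r) = 6 * int (Suc m choose 3)"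
      unfolding sum_T choose by (simp add: algebra_simps power2_eq_square)
    then show ?thesis by simp
  qed
  ultimately have T: "(\<Prod>r<m. q powi T r) = q ^ (Suc m choose 3)"
    by simp
  have rev: "(\<Prod>r<m. qfac (2 * m - 1 - 2 * r)) = (\<Prod>r<m. qfac (2 * r + 1))"
    by (rule prod.reindex_bij_witness[where i = "\<lambda>r. m - 1 - r" and j = "\<lambda>r. m - 1 - r"])
      (auto intro!: arg_cong[where f = qfac])
  have "(\<Prod>r<m. elem_row N m r) * (\<Prod>r<m. complete_row N m r) =
    (\<Prod>r<m. q powi T r * (1 - q powi (int N + (int m - 1 - 2 * int r))) * (1 - q ^ N) /
      (qfac (2 * r + 1) * qfac (2 * m - 1 - 2 * r)))"
    unfolding prod.distrib[symmetric]
  proof (rule prod.cong[OF refl])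
    fix r assume "r \<in> {..<m}"
    then have r: "r < m" by simp
    obtain N' where N: "N = Suc N'"
      using assms(2) by (cases N) auto
    define K where "K = N + m - 2 - 2 * r"
    have K: "N + m - 1 - 2 * r = Suc K"
      using r assms by (simp add: K_def)
    have "int N + (int m - 1 - 2 * int r) = int (Suc K)"
      using r assms by (simp add: K_def)
    then have K': "q powi (int N + (int m - 1 - 2 * int r)) = q ^ Suc K"
      by (simp only: power_int_of_nat)
    show "elem_row N m r * complete_row N m r =
      q powi T r * (1 - q powi (int N + (int m - 1 - 2 * int r))) * (1 - q ^ N) /
      (qfac (2 * r + 1) * qfac (2 * m - 1 - 2 * r))"
      unfolding elem_row_def complete_row_def K K' K_def[symmetric] T_def[symmetric] qfac_Suc
      unfolding N qfac_Suc by simp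
  qed
  also have "\<dots> = q ^ (Suc m choose 3) * (\<Prod>r<m. 1 - q powi (int N + (int m - 1 - 2 * int r))) *
      (1 - q ^ N) ^ m / (\<Prod>r<m. qfac (2 * r + 1))\<^sup>2"
    unfolding prod_dividef prod.distrib rev T by (simp add: power2_eq_square)
  finally show ?thesis .
qed

text \<open>
  The column factors of \<open>e\<close> turn \<open>1 - q\<^bsup>-N-t\<^esup>\<close> into \<open>1 - q\<^bsup>N+t\<^esup>\<close>.
\<close>

lemma prod_cols:
  "(\<Prod>i<m. elem_col N i) * (\<Prod>i<m. \<Prod>t\<in>{1..i}. 1 - 1 / q ^ N * q powi - int t) * q ^ (Suc m choose 3) =
    (\<Prod>i<m. \<Prod>t\<in>{1..i}. 1 - q powi (int N + int t))"
proof -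
  have "elem_col N i * (\<Prod>t\<in>{1..i}. 1 - 1 / q ^ N * q powi - int t) * q ^ (Suc i choose 2) =
    (\<Prod>t\<in>{1..i}. 1 - q powi (int N + int t))" for i
  proof -
    have sq: "q ^ (Suc i choose 2) * q ^ (Suc i choose 2) = (\<Prod>t\<in>{1..i}. q ^ t * q ^ t)"
    proof (induction i)
      case (Suc i)
      have "Suc (Suc i) choose 2 = (Suc i choose 2) + Suc i"
        by (simp add: numeral_2_eq_2)
      then have "q ^ (Suc (Suc i) choose 2) = q ^ (Suc i choose 2) * q ^ Suc i"
        by (simp only: power_add)
      then show ?case
        using Suc.IH by (simp add: mult_ac)
    qed (simp add: numeral_2_eq_2)
    have "elem_col N i * (\<Prod>t\<in>{1..i}. 1 - 1 / q ^ N * q powi - int t) * q ^ (Suc i choose 2) =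
      (q ^ (Suc i choose 2) * q ^ (Suc i choose 2)) * ((\<Prod>t\<in>{1..i}. - (q ^ N / q ^ t)) *
        (\<Prod>t\<in>{1..i}. 1 - 1 / q ^ N * q powi - int t))"
      unfolding elem_col_def by (simp only: mult_ac)
    also have "\<dots> = (\<Prod>t\<in>{1..i}. q ^ t * q ^ t * (- (q ^ N / q ^ t) * (1 - 1 / q ^ N * q powi - int t)))"
      unfolding sq prod.distrib ..
    also have "\<dots> = (\<Prod>t\<in>{1..i}. 1 - q powi (int N + int t))"
      by (rule prod.cong[OF refl]) (simp add: power_int_minus power_int_add field_simps)
    finally show ?thesis .
  qed
  then show ?thesis
    by (simp only: prod_choose_2[symmetric] prod.distrib[symmetric])
qed

text \<open>
  Each determinant contributes \<open>L\<close>, and the two Vandermonde quotients contribute \<open>S\<^sup>2\<close>. Since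
  \<open>S L O' = W\<close>, this turns the denominator \<open>W\<^sup>2\<close> of the row factors into \<open>O'\<^sup>2\<close>. The remaining linear
  factors are those of the squared content product.
\<close>

theorem schur_Q_even_staircase_principal:
  assumes "1 \<le> m" "m \<le> N"
  shows "schur_Q N (map (\<lambda>i. 2 * (m - i)) [0..<m]) (\<lambda>i. q ^ i) =
    2 ^ m * q ^ (2 * (Suc m choose 3)) *
    (\<Prod>i=1..m. (qpoch (q ^ (N - m + i)) q i)\<^sup>2 / (qpoch q (q\<^sup>2) i)\<^sup>2)"
proof -
  define \<epsilon> where "\<epsilon> = (\<Prod>j<m. \<Prod>i<j. - 1 :: 'a)"
  define c3 where "c3 = Suc m choose 3"
  define y where "y = vandermonde m (\<lambda>i. q powi - int (Suc i))"
  define v where "v = vandermonde m (\<lambda>r. q powi (2 * int r + 1 - int m))"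
  define v' where "v' = vandermonde m (\<lambda>r. q powi (int m - 1 - 2 * int r))"
  define D where "D = detf m (\<lambda>r i. poly (interp m (1 / q ^ N) i) (q powi (2 * int r + 1 - int m)))"
  define D' where "D' = detf m (\<lambda>r j. poly (interp m (q ^ N) j) (q powi (int m - 1 - 2 * int r)))"
  define S where "S = (\<Prod>j<m. \<Prod>i<j. 1 + q ^ (j - i))"
  define L where "L = (\<Prod>i<m. qfac (m - 1 - i))"
  define O' where "O' = (\<Prod>i<m. qpoch q (q\<^sup>2) (Suc i))"
  define W where "W = (\<Prod>r<m. qfac (2 * r + 1))"
  define P where "P = (\<Prod>i<m. \<Prod>t\<in>{1..i}. 1 - 1 / q ^ N * q powi - int t)"
  define U where "U = (\<Prod>i<m. \<Prod>t\<in>{1..i}. 1 - q powi (int N + int t))"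
  define U' where "U' = (\<Prod>i<m. \<Prod>t\<in>{1..i}. 1 - q ^ N * q powi - int t)"
  define B where "B = (\<Prod>r<m. 1 - q powi (int N + (int m - 1 - 2 * int r)))"
  define R where "R = (\<Prod>r<m. elem_row N m r)"
  define R' where "R' = (\<Prod>r<m. complete_row N m r)"
  define E where "E = (\<Prod>i<m. elem_col N i)"
  have N: "N \<ge> 1" using assms by simp
  have y0: "y \<noteq> 0"
    unfolding y_def by (rule vandermonde_nodes_nonzero)
  have D: "D * y = v * (L * P)"
    unfolding D_def y_def v_def L_def P_def interp_det prod.distrib ..
  have D': "D' * y = v' * (L * U')"
    unfolding D'_def y_def v'_def L_def U'_def interp_det prod.distrib ..
  have V: "\<epsilon> * v * v' = q ^ (2 * c3) * S\<^sup>2 * y\<^sup>2"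
    unfolding \<epsilon>_def v_def v'_def S_def y_def c3_def by (rule vandermonde_quotient)
  have W: "S * L * O' = W"
    unfolding S_def L_def O'_def W_def by (rule odd_qfac_factorization)
  have RR: "R * R' = q ^ c3 * B * (1 - q ^ N) ^ m / W\<^sup>2"
    unfolding R_def R'_def c3_def B_def W_def by (rule prod_rows[OF assms(2) N])
  have EP: "E * P * q ^ c3 = U"
    unfolding E_def P_def U_def c3_def by (rule prod_cols)
  have W0: "W \<noteq> 0"
    by (simp add: W_def)
  have num: "(\<Prod>i=1..m. qpoch (q ^ (N - m + i)) q i)\<^sup>2 = B * (1 - q ^ N) ^ m * U * U'"
  proof -
    have "(\<Prod>i=1..m. qpoch (q ^ (N - m + i)) q i) =
      (\<Prod>i\<in>{1..m}. \<Prod>k<i. 1 - q powi (int N + (int i + int k - int m)))"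
      unfolding qpoch_def
    proof (intro prod.cong refl)
      fix i k
      have "int N + (int i + int k - int m) = int (N - m + i + k)"
        using assms by simp
      then have "q powi (int N + (int i + int k - int m)) = q ^ (N - m + i + k)"
        by (simp only: power_int_of_nat)
      then show "1 - q ^ (N - m + i) * q ^ k = 1 - q powi (int N + (int i + int k - int m))"
        by (simp only: power_add)
    qed
    then have "(\<Prod>i=1..m. qpoch (q ^ (N - m + i)) q i)\<^sup>2 =
      (\<Prod>i\<in>{1..m}. \<Prod>k<i. 1 - q powi (int N + (int i + int k - int m)))\<^sup>2"
      by (rule arg_cong)
    also have "\<dots> = B * (\<Prod>l<m. (1 - q powi (int N + 0)) *
        (\<Prod>t\<in>{1..l}. (1 - q powi (int N + - int t)) * (1 - q powi (int N + int t))))"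
      unfolding B_def by (rule staircase_square)
    also have "(\<Prod>l<m. (1 - q powi (int N + 0)) *
        (\<Prod>t\<in>{1..l}. (1 - q powi (int N + - int t)) * (1 - q powi (int N + int t)))) =
      (1 - q ^ N) ^ m * (U' * U)"
    proof -
      have "q powi (int N + - int t) = q ^ N * q powi - int t" for t
        unfolding power_int_add[OF disjI1[OF q_nonzero]] by simp
      then show ?thesis
        unfolding U_def U'_def by (simp only: prod.distrib) simp
    qed
    finally show ?thesis by (simp only: mult_ac)
  qed
  have "schur_Q N (map (\<lambda>i. 2 * (m - i)) [0..<m]) (\<lambda>i. q ^ i) =
    2 ^ m * (\<epsilon> * detf m (\<lambda>i j. moment N (i + j + 2)))"
    unfolding moment_def \<epsilon>_def
  proof (rule schur_Q_even_staircase[OF assms(2)])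
    fix a b :: nat assume "a \<noteq> b"
    then have "(q ^ a)\<^sup>2 \<noteq> (q ^ b)\<^sup>2"
      using q_power_inj[of "a * 2" "b * 2"] by (auto simp flip: power_mult)
    then have "(q ^ a - q ^ b) * (q ^ a + q ^ b) \<noteq> 0"
      by (simp add: algebra_simps power2_eq_square)
    then show "q ^ a - q ^ b \<noteq> 0 \<and> q ^ a + q ^ b \<noteq> 0"
      by simp
  qed
  also have "detf m (\<lambda>i j. moment N (i + j + 2)) = R * E * D * (R' * D')"
    unfolding R_def E_def D_def R'_def D'_def by (rule moment_det_eq[OF assms(2) N])
  also have "\<epsilon> * (R * E * D * (R' * D')) = q ^ (2 * c3) * (B * (1 - q ^ N) ^ m * U * U') / O'\<^sup>2"
  proof -
    have "\<epsilon> * (R * E * D * (R' * D')) * y\<^sup>2 = (R * R') * E * \<epsilon> * (D * y) * (D' * y)"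
      by (simp only: power2_eq_square mult_ac)
    also have "\<dots> = (R * R') * E * P * (\<epsilon> * v * v') * (L * L * U')"
      unfolding D D' by (simp only: mult_ac)
    also have "\<dots> = (B * (1 - q ^ N) ^ m / W\<^sup>2) * (E * P * q ^ c3) * (q ^ (2 * c3) * S\<^sup>2) * (L * L * U') * y\<^sup>2"
      unfolding RR V by (simp add: mult_ac)
    finally have eq: "\<epsilon> * (R * E * D * (R' * D')) * y\<^sup>2 =
      (B * (1 - q ^ N) ^ m / W\<^sup>2) * U * (q ^ (2 * c3) * S\<^sup>2) * (L * L * U') * y\<^sup>2"
      unfolding EP .
    have "y\<^sup>2 \<noteq> 0"
      using y0 by simp
    from iffD1[OF mult_right_cancel[OF this] eq] have "\<epsilon> * (R * E * D * (R' * D')) =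
      (B * (1 - q ^ N) ^ m / W\<^sup>2) * U * (q ^ (2 * c3) * S\<^sup>2) * (L * L * U')" .
    also have "\<dots> = q ^ (2 * c3) * (B * (1 - q ^ N) ^ m * U * U') * ((S * L)\<^sup>2 / W\<^sup>2)"
      by (simp add: power2_eq_square mult_ac)
    also have "(S * L)\<^sup>2 / W\<^sup>2 = 1 / O'\<^sup>2"
      using W0 unfolding W[symmetric] by (simp add: power_mult_distrib)
    finally show ?thesis by simp
  qed
  also have "\<dots> = q ^ (2 * c3) *
    (\<Prod>i=1..m. (qpoch (q ^ (N - m + i)) q i)\<^sup>2 / (qpoch q (q\<^sup>2) i)\<^sup>2)"
  proof -
    have "O' = (\<Prod>i=1..m. qpoch q (q\<^sup>2) i)"
      unfolding O'_def
      by (rule prod.reindex_bij_witness[where i = "\<lambda>i. i - 1" and j = Suc]) auto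
    then show ?thesis
      unfolding num[symmetric] prod_dividef prod_power_distrib[symmetric] by simp
  qed
  finally show ?thesis
    unfolding c3_def by (simp only: mult.assoc)
qed

end

theorem corollary7p6:
  fixes q :: complex and m n :: nat
  assumes "q \<noteq> 0"
    and "\<forall>k\<ge>1. q ^ k \<noteq> 1"
    and "m \<ge> 1"
    and "n \<ge> m - 1"
  shows "schur_Q (n + 1) (map (\<lambda>i. 2 * (m - i)) [0..<m]) (\<lambda>i. q ^ i) =
    2 ^ m * q ^ (2 * ((m + 1) choose 3)) *
    (\<Prod>i=1..m. (qpoch (q ^ (n + 1 - m + i)) q i)\<^sup>2 / (qpoch q (q\<^sup>2) i)\<^sup>2)"
proof -
  interpret generic_parameter q
    by standard (use assms in auto)
  show ?thesis
    using schur_Q_even_staircase_principal[of m "n + 1"] assms(3,4) by simp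
qed

end
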